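(* For every fixed $r>0$, the inverse Fourier representation of the three-dimensional velocity fundamental solution $G_1^{(3)}(t,\cdot)$ defines a function $K_r(t):=G_1^{(3)}(t,r)$ such that $$K_r\in\mathcal C\bigl((0,\infty)\bigr)\cap L^1_{\mathrm{loc}}\bigl([0,\infty)\bigr).$$ Moreover, for every $s>0$, $$\int_0^\infty \mathrm e^{-st}K_r(t)\,\mathrm dt=\frac{1}{4\pi r(1+s)}\,\mathrm e^{-\frac{rs}{\sqrt{1+s}}}.$$ Consequently, the nonnegative Radon measure $\mu_r$ on $[0,\infty)$ characterized by $\int_{[0,\infty)}\mathrm e^{-st}\mu_r(\mathrm dt)=\frac{1}{4\pi r(1+s)}\mathrm e^{-rs/\sqrt{1+s}}$ for all $s>0$ (which exists) is absolutely continuous with respect to Lebesgue measure and satisfies $\mu_r(\mathrm dt)=K_r(t)\,\mathrm dt$. In particular, $$G_1^{(3)}(t,r)\geqslant0\quad\text{for every }t>0\text{ and }r>0.$$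
   Context: For $\rho\geqslant0$ let $\widehat S_1(t,\rho)$ be the solution of the ODE in $t$, $y''+\rho^2y'+\rho^2y=0$, $y(0)=0$, $y'(0)=1$. Explicitly, $\widehat S_1(t,\rho)=\mathrm e^{-t\rho^2/2}\frac{\sin(t\omega(\rho))}{\omega(\rho)}$ with $\omega(\rho)=\rho\sqrt{1-\rho^2/4}$ for $0<\rho<2$ (with value $t$ at $\rho=0$), $\widehat S_1(t,2)=t\mathrm e^{-2t}$, and $\widehat S_1(t,\rho)=\frac{\mathrm e^{\lambda_+t}-\mathrm e^{\lambda_-t}}{\lambda_+-\lambda_-}$ with $\lambda_\pm=\frac{-\rho^2\pm\rho\sqrt{\rho^2-4}}{2}$ for $\rho>2$. $G_1^{(3)}(t,x)$, $x\in\mathbb R^3$, is the tempered distribution whose spatial Fourier transform (convention $\widehat f(\zeta)=\int \mathrm e^{-ix\cdot\zeta}f(x)\,\mathrm dx$) is $\widehat S_1(t,|\zeta|)$; it is the velocity fundamental solution of $v_{tt}-\Delta v-\Delta v_t=0$. It is radial and, for $r=|x|>0$, one writes $G_1^{(3)}(t,r)=G_1^{(3)}(t,x)$; pointwise it is given by the radial inversion formula $G_1^{(3)}(t,r)=\frac{1}{2\pi^2r}\lim_{R\to\infty}\int_0^R\widehat S_1(t,\rho)\,\rho\sin(r\rho)\,\mathrm d\rho$. *)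

theory Defs
  imports "HOL-Analysis.Analysis"
begin

definition omega :: "real \<Rightarrow> real" where
  "omega \<rho> = \<rho> * sqrt (1 - \<rho>\<^sup>2 / 4)"

definition lambda_plus :: "real \<Rightarrow> real" where
  "lambda_plus \<rho> = (- \<rho>\<^sup>2 + \<rho> * sqrt (\<rho>\<^sup>2 - 4)) / 2"

definition lambda_minus :: "real \<Rightarrow> real" where
  "lambda_minus \<rho> = (- \<rho>\<^sup>2 - \<rho> * sqrt (\<rho>\<^sup>2 - 4)) / 2"

text \<open>The spatial Fourier symbol of the velocity fundamental solution of
  \<open>v_tt - \<Delta>v - \<Delta>v_t = 0\<close>, as a function of \<open>t\<close> and \<open>\<rho> = |\<zeta>| \<ge> 0\<close>. Lemma
  \<open>S1_hat_solves_ode\<close> below confirms that it solves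
  \<open>y'' + \<rho>\<^sup>2 y' + \<rho>\<^sup>2 y = 0\<close>, \<open>y 0 = 0\<close>, \<open>y' 0 = 1\<close>.\<close>

definition S1_hat :: "real \<Rightarrow> real \<Rightarrow> real" where
  "S1_hat t \<rho> =
    (if \<rho> = 0 then t
     else if \<rho> < 2 then exp (- t * \<rho>\<^sup>2 / 2) * (sin (t * omega \<rho>) / omega \<rho>)
     else if \<rho> = 2 then t * exp (- 2 * t)
     else (exp (lambda_plus \<rho> * t) - exp (lambda_minus \<rho> * t))
          / (lambda_plus \<rho> - lambda_minus \<rho>))"

lemma S1_hat_solves_ode:
  assumes "\<rho> \<ge> 0"
  shows "\<exists>y' y''. (\<forall>t. ((\<lambda>t. S1_hat t \<rho>) has_real_derivative y' t) (at t))
    \<and> (\<forall>t. (y' has_real_derivative y'' t) (at t))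
    \<and> (\<forall>t. y'' t + \<rho>\<^sup>2 * y' t + \<rho>\<^sup>2 * S1_hat t \<rho> = 0)
    \<and> S1_hat 0 \<rho> = 0 \<and> y' 0 = 1"
proof -
  consider "\<rho> = 0" | "0 < \<rho>" "\<rho> < 2" | "\<rho> = 2" | "\<rho> > 2"
    using assms by linarith
  then show ?thesis
  proof cases
    case 1
    show ?thesis
      unfolding S1_hat_def using 1
      by (intro exI[of _ "\<lambda>_. 1"] exI[of _ "\<lambda>_. 0"]) (auto intro!: derivative_eq_intros)
  next
    case 2
    define a w where "a = \<rho>\<^sup>2 / 2" and "w = omega \<rho>"
    have "\<rho>\<^sup>2 < 2\<^sup>2"
      using 2 by (intro power_strict_mono) auto
    then have lt: "1 - \<rho>\<^sup>2 / 4 > 0" by simp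
    then have w: "w \<noteq> 0" using 2 by (simp add: w_def omega_def)
    have w2: "w\<^sup>2 = \<rho>\<^sup>2 - a\<^sup>2"
      using lt by (simp add: w_def omega_def a_def power_mult_distrib)
        (simp add: field_simps power2_eq_square)
    have r: "\<rho>\<^sup>2 = 2 * a" by (simp add: a_def)
    have S: "S1_hat t \<rho> = exp (- a * t) * sin (w * t) / w" for t
      using 2 by (simp add: S1_hat_def w_def a_def mult.commute)
    define y' where "y' t = exp (- a * t) * (cos (w * t) - a * sin (w * t) / w)" for t
    define y'' where "y'' t = exp (- a * t) *
      (- a * (cos (w * t) - a * sin (w * t) / w) - w * sin (w * t) - a * cos (w * t))" for t
    have "((\<lambda>t. S1_hat t \<rho>) has_real_derivative y' t) (at t)" for t
      unfolding S y'_def using w by (auto intro!: derivative_eq_intros simp: field_simps)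
    moreover have "(y' has_real_derivative y'' t) (at t)" for t
      unfolding y'_def[abs_def] y''_def using w
      by (auto intro!: derivative_eq_intros simp: field_simps)
    moreover have "y'' t + \<rho>\<^sup>2 * y' t + \<rho>\<^sup>2 * S1_hat t \<rho> = 0" for t
    proof -
      have "y'' t + \<rho>\<^sup>2 * y' t + \<rho>\<^sup>2 * S1_hat t \<rho>
        = exp (- a * t) * sin (w * t) * (2 * a - a\<^sup>2 - w\<^sup>2) / w"
        unfolding S y'_def y''_def r using w by (simp add: field_simps power2_eq_square)
      then show ?thesis using w2 r by simp
    qed
    moreover have "S1_hat 0 \<rho> = 0" "y' 0 = 1"
      by (simp_all add: S y'_def)
    ultimately show ?thesis by blast
  next
    case 3
    have S: "S1_hat t \<rho> = t * exp (- 2 * t)" for t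
      using 3 by (simp add: S1_hat_def)
    show ?thesis
      unfolding S using 3
      by (intro exI[of _ "\<lambda>t. (1 - 2 * t) * exp (- 2 * t)"]
            exI[of _ "\<lambda>t. (4 * t - 4) * exp (- 2 * t)"])
        (auto intro!: derivative_eq_intros simp: algebra_simps)
  next
    case 4
    define p q where "p = lambda_plus \<rho>" and "q = lambda_minus \<rho>"
    have "\<rho>\<^sup>2 > 2\<^sup>2"
      using 4 by (intro power_strict_mono) auto
    then have gt: "\<rho>\<^sup>2 - 4 > 0" by simp
    have "p - q = \<rho> * sqrt (\<rho>\<^sup>2 - 4)"
      by (simp add: p_def q_def lambda_plus_def lambda_minus_def field_simps)
    then have pq: "p - q \<noteq> 0" using gt 4 by simp
    have root: "x\<^sup>2 + \<rho>\<^sup>2 * x + \<rho>\<^sup>2 = 0" if "x = p \<or> x = q" for x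
    proof -
      have "2 * x + \<rho>\<^sup>2 = \<rho> * sqrt (\<rho>\<^sup>2 - 4) \<or> 2 * x + \<rho>\<^sup>2 = - (\<rho> * sqrt (\<rho>\<^sup>2 - 4))"
        using that by (auto simp: p_def q_def lambda_plus_def lambda_minus_def)
      then have "(2 * x + \<rho>\<^sup>2)\<^sup>2 = (\<rho> * sqrt (\<rho>\<^sup>2 - 4))\<^sup>2"
        by auto
      also have "\<dots> = \<rho>\<^sup>2 * (\<rho>\<^sup>2 - 4)"
        using gt by (simp add: power_mult_distrib)
      finally have "(2 * x + \<rho>\<^sup>2)\<^sup>2 = \<rho>\<^sup>2 * (\<rho>\<^sup>2 - 4)" .
      then show ?thesis by (simp add: power2_eq_square algebra_simps)
    qed
    have S: "S1_hat t \<rho> = (exp (p * t) - exp (q * t)) / (p - q)" for t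
      using 4 by (simp add: S1_hat_def p_def q_def)
    define y' where "y' t = (p * exp (p * t) - q * exp (q * t)) / (p - q)" for t
    define y'' where "y'' t = (p\<^sup>2 * exp (p * t) - q\<^sup>2 * exp (q * t)) / (p - q)" for t
    have "((\<lambda>t. S1_hat t \<rho>) has_real_derivative y' t) (at t)" for t
      unfolding S y'_def by (rule derivative_eq_intros refl | use pq in simp)+
    moreover have "(y' has_real_derivative y'' t) (at t)" for t
      unfolding y'_def[abs_def] y''_def
      by (rule derivative_eq_intros refl | use pq in \<open>simp add: power2_eq_square\<close>)+
    moreover have "y'' t + \<rho>\<^sup>2 * y' t + \<rho>\<^sup>2 * S1_hat t \<rho> = 0" for t
    proof -
      have "y'' t + \<rho>\<^sup>2 * y' t + \<rho>\<^sup>2 * S1_hat t \<rho>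
        = (exp (p * t) * (p\<^sup>2 + \<rho>\<^sup>2 * p + \<rho>\<^sup>2) - exp (q * t) * (q\<^sup>2 + \<rho>\<^sup>2 * q + \<rho>\<^sup>2)) / (p - q)"
        unfolding S y'_def y''_def
        by (simp add: diff_divide_distrib add_divide_distrib algebra_simps)
      then show ?thesis using root[of p] root[of q] by simp
    qed
    moreover have "S1_hat 0 \<rho> = 0" "y' 0 = 1"
      using pq by (simp_all add: S y'_def)
    ultimately show ?thesis by blast
  qed
qed

text \<open>The inverse Fourier integral of the radial function \<open>\<zeta> \<mapsto> S1_hat t |\<zeta>|\<close> on \<open>\<real>\<^sup>3\<close>,
  in polar coordinates and cut off at \<open>|\<zeta>| \<le> R\<close>, evaluated at \<open>|x| = r > 0\<close>. For fixed
  \<open>t > 0\<close> the symbol decays only like \<open>1 / \<rho>\<^sup>2\<close>, so the limit \<open>R \<rightarrow> \<infinity>\<close> is a conditionally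
  convergent improper integral.\<close>

definition G1_trunc :: "real \<Rightarrow> real \<Rightarrow> real \<Rightarrow> real" where
  "G1_trunc t r R =
    1 / (2 * pi\<^sup>2 * r) * (LBINT \<rho>:{0..R}. S1_hat t \<rho> * \<rho> * sin (r * \<rho>))"

text \<open>\<open>Lim\<close> is meaningful only where the limit exists; existence has to be established
  separately.\<close>

definition G1 :: "real \<Rightarrow> real \<Rightarrow> real" where
  "G1 t r = Lim at_top (G1_trunc t r)"

text \<open>On the half-line a Borel measure is Radon iff it is finite on compact sets, inner
  regularity being automatic.\<close>

definition radon_on_half_line :: "real measure \<Rightarrow> bool" where
  "radon_on_half_line M \<longleftrightarrow>
    sets M = sets (restrict_space borel {0..}) \<and>
    (\<forall>C. compact C \<and> C \<subseteq> {0..} \<longrightarrow> emeasure M C < \<infinity>)"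

definition has_laplace_kernel :: "real \<Rightarrow> real measure \<Rightarrow> bool" where
  "has_laplace_kernel r M \<longleftrightarrow> radon_on_half_line M \<and>
    (\<forall>s>0. (\<integral>\<^sup>+ t. ennreal (exp (- s * t)) \<partial>M)
      = ennreal (1 / (4 * pi * r * (1 + s)) * exp (- r * s / sqrt (1 + s))))"

end

theory Submission
  imports Defs "HOL-Probability.Probability" "HOL-Real_Asymp.Real_Asymp"
begin

text \<open>
  The Laplace transform in time links the oscillatory integral that defines \<open>G1\<close> with a formula
  from which positivity can be read off.

  For each \<open>\<rho>\<close> the symbol \<open>S1_hat t \<rho>\<close> has the Laplace transform
  \<open>1 / (s\<^sup>2 + s * \<rho>\<^sup>2 + \<rho>\<^sup>2) = 1 / ((1 + s) * (\<rho>\<^sup>2 + a\<^sup>2))\<close> with \<open>a = s / sqrt (1 + s)\<close>. Hence the transform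
  of the truncated inversion integral is a truncated sine transform of \<open>\<rho> / (\<rho>\<^sup>2 + a\<^sup>2)\<close>, which
  tends to \<open>pi / 2 * exp (- a * r)\<close> (\<open>sine_transform_resolvent\<close>); this is the asserted formula.

  Passing to the limit under the Laplace integral requires estimates that are uniform in \<open>t\<close>,
  although the inversion integral converges only conditionally. For \<open>\<rho> > 2\<close> the amplitude
  \<open>\<rho> * S1_hat t \<rho>\<close> is a difference of two products of monotone factors, so the second mean value
  theorem bounds the tail beyond \<open>A\<close> by a constant multiple of \<open>1 / (r * sqrt (A\<^sup>2 - 4))\<close>, whatever
  \<open>t \<ge> 0\<close> is (\<open>oscillatory_tail_bound\<close>). This gives the existence of the limit, its continuity in
  \<open>t\<close>, and a dominating function of linear growth.

  For the sign, put \<open>p = 1 + s\<close>. Because \<open>s / sqrt p = sqrt p - 1 / sqrt p\<close>, the right-hand side is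
  \<open>1 / (4 * pi * r)\<close> times \<open>exp (- r * sqrt p)\<close> times \<open>exp (r / sqrt p) / p\<close>. The first factor is the
  transform of the Levy density, the second expands into a series of powers \<open>p powr (- n / 2 - 1)\<close>
  with positive coefficients; so some nonnegative function \<open>h\<close> has the same Laplace transform as
  \<open>G1\<close> (\<open>nonnegative_laplace_preimage\<close>). A measure on the half-line is determined by its Laplace
  transform (\<open>laplace_transform_determines_measure\<close>); applied to \<open>G1\<^sup>+ dt\<close> and \<open>(h + G1\<^sup>-) dt\<close> this shows
  \<open>G1 \<ge> 0\<close> almost everywhere, and everywhere by continuity. Then \<open>G1 dt\<close> is itself a measure with
  the prescribed transform, and the same uniqueness makes it the only one.
\<close>

section \<open>Integration over the half-line\<close>

text \<open>Integrands may change sign here: by dominated convergence the integral is the limit of the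
  integrals over \<open>{a..y}\<close>.\<close>

lemma LBINT_FTC_atLeast:
  fixes f F :: "real \<Rightarrow> real"
  assumes f: "set_integrable lborel {a..} f"
    and F: "\<And>x. a \<le> x \<Longrightarrow> (F has_real_derivative f x) (at x)"
    and c: "continuous_on {a..} f"
    and L: "(F \<longlongrightarrow> L) at_top"
  shows "(LBINT x:{a..}. f x) = L - F a"
proof -
  have 1: "((\<lambda>y. LBINT x. indicator {..y} x *\<^sub>R (indicator {a..} x *\<^sub>R f x)) \<longlongrightarrow>
      (LBINT x:{a..}. f x)) at_top"
    using tendsto_integral_at_top[OF sets_lborel f[unfolded set_integrable_def]]
    by (simp add: set_lebesgue_integral_def)
  have 2: "(LBINT x. indicator {..y} x *\<^sub>R (indicator {a..} x *\<^sub>R f x)) = F y - F a" if "y \<ge> a" for y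
  proof -
    have "(LBINT x. indicator {..y} x *\<^sub>R (indicator {a..} x *\<^sub>R f x))
      = (LBINT x. indicator {a..y} x *\<^sub>R f x)"
      by (intro Bochner_Integration.integral_cong) (auto simp: indicator_def)
    also have "\<dots> = F y - F a"
    proof (rule integral_FTC_atLeastAtMost[OF that])
      show "(F has_vector_derivative f x) (at x within {a..y})" if "a \<le> x" for x
        using F[OF that] by (simp add: has_real_derivative_iff_has_vector_derivative
            has_vector_derivative_at_within)
      show "continuous_on {a..y} f" using c by (rule continuous_on_subset) auto
    qed
    finally show ?thesis .
  qed
  have "((\<lambda>y. F y - F a) \<longlongrightarrow> L - F a) at_top" by (intro tendsto_intros L)
  then have "((\<lambda>y. LBINT x. indicator {..y} x *\<^sub>R (indicator {a..} x *\<^sub>R f x)) \<longlongrightarrow> L - F a) at_top"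
    by (rule Lim_transform_eventually) (use 2 in \<open>auto intro: eventually_mono[OF eventually_ge_at_top[of a]]\<close>)
  with 1 show ?thesis by (rule tendsto_unique[rotated]) simp
qed

lemma set_integrable_FTC_atLeast_nonneg:
  fixes f F :: "real \<Rightarrow> real"
  assumes f: "f \<in> borel_measurable borel"
    and F: "\<And>x. a \<le> x \<Longrightarrow> (F has_real_derivative f x) (at x)"
    and n: "\<And>x. a \<le> x \<Longrightarrow> 0 \<le> f x"
    and L: "(F \<longlongrightarrow> L) at_top"
  shows "set_integrable lborel {a..} f"
proof -
  have "(\<integral>\<^sup>+x. ennreal (f x) * indicator {a..} x \<partial>lborel) = ennreal (L - F a)"
    by (rule nn_integral_FTC_atLeast) (use assms in auto)
  also have "(\<integral>\<^sup>+x. ennreal (f x) * indicator {a..} x \<partial>lborel)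
      = (\<integral>\<^sup>+x. ennreal (norm (indicator {a..} x *\<^sub>R f x)) \<partial>lborel)"
    by (intro nn_integral_cong) (use n in \<open>auto simp: indicator_def\<close>)
  finally show ?thesis
    unfolding set_integrable_def using f by (intro integrableI_bounded) auto
qed

lemma set_integrable_exp:
  fixes s :: real
  assumes "s > 0"
  shows "set_integrable lborel {0..} (\<lambda>t. exp (- s * t))"
proof (rule set_integrable_FTC_atLeast_nonneg)
  show "((\<lambda>t. - exp (- s * t) / s) \<longlongrightarrow> 0) at_top"
    using assms by real_asymp
  show "((\<lambda>t. - exp (- s * t) / s) has_real_derivative exp (- s * x)) (at x)" for x
    using assms by (auto intro!: derivative_eq_intros)
qed auto

lemma set_integrable_exp_mult:
  fixes s c :: real
  assumes "s > 0"
  shows "set_integrable lborel {0..} (\<lambda>t. (c + t) * exp (- s * t))"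
proof -
  have "set_integrable lborel {0..} (\<lambda>t. t * exp (- s * t))"
  proof (rule set_integrable_FTC_atLeast_nonneg)
    show "((\<lambda>t. - (exp (- s * t) * (t / s + 1 / s\<^sup>2))) \<longlongrightarrow> 0) at_top"
      using assms by real_asymp
    show "((\<lambda>t. - (exp (- s * t) * (t / s + 1 / s\<^sup>2))) has_real_derivative x * exp (- s * x)) (at x)" for x
      using assms by (auto intro!: derivative_eq_intros simp: field_simps power2_eq_square)
  qed auto
  then show ?thesis
    using set_integral_add(1)[OF set_integrable_mult_right[OF set_integrable_exp[OF assms], of c]]
    by (simp add: algebra_simps)
qed

text \<open>The order of integration can be changed because the strip has finite width and the integrand
  is dominated by a function of the unbounded variable alone.\<close>

lemma Fubini_strip:
  fixes f :: "real \<Rightarrow> real \<Rightarrow> real"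
  assumes meas [measurable]: "(\<lambda>(x, y). f x y) \<in> borel_measurable (borel \<Otimes>\<^sub>M borel)"
    and bd: "\<And>x y. a \<le> x \<Longrightarrow> x \<le> b \<Longrightarrow> 0 \<le> y \<Longrightarrow> \<bar>f x y\<bar> \<le> g y"
    and g: "set_integrable lborel {0..} g"
  shows "(LBINT y:{0..}. LBINT x:{a..b}. f x y) = (LBINT x:{a..b}. LBINT y:{0..}. f x y)"
proof -
  let ?h = "\<lambda>x y. indicator {a..b} x * indicator {0..} y * f x y"
  have dom: "integrable (lborel \<Otimes>\<^sub>M lborel) (\<lambda>(x, y). indicator {a..b} x * (indicator {0..} y * g y))"
  proof (rule lborel_pair.Fubini_integrable)
    have gm: "(\<lambda>y. indicator {0..} y * g y) \<in> borel_measurable lborel"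
      using borel_measurable_integrable[OF g[unfolded set_integrable_def]] by simp
    show "(\<lambda>(x, y). indicator {a..b} x * (indicator {0..} y * g y)) \<in> borel_measurable (lborel \<Otimes>\<^sub>M lborel)"
      using gm by measurable
    have "integrable lborel (\<lambda>x. indicator {a..b} x * (LBINT y. norm (indicator {0..} y * g y)))"
      by (intro integrable_mult_left integrable_real_indicator) (auto simp: emeasure_lborel_Icc_eq)
    then show "integrable lborel (\<lambda>x. LBINT y. norm (case (x, y) of (x, y) \<Rightarrow> indicator {a..b} x * (indicator {0..} y * g y)))"
      by (simp add: abs_mult)
    show "AE x in lborel. integrable lborel (\<lambda>y. case (x, y) of (x, y) \<Rightarrow> indicator {a..b} x * (indicator {0..} y * g y))"
      using g by (simp add: set_integrable_def)
  qed
  have int: "integrable (lborel \<Otimes>\<^sub>M lborel) (\<lambda>(x, y). ?h x y)"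
  proof (rule Bochner_Integration.integrable_bound[OF dom])
    show "(\<lambda>(x, y). ?h x y) \<in> borel_measurable (lborel \<Otimes>\<^sub>M lborel)" by measurable
    show "AE z in lborel \<Otimes>\<^sub>M lborel. norm (case z of (x, y) \<Rightarrow> ?h x y)
        \<le> norm (case z of (x, y) \<Rightarrow> indicator {a..b} x * (indicator {0..} y * g y))"
      using bd by (intro AE_I2) (force simp: indicator_def)
  qed
  have "(LBINT y:{0..}. LBINT x:{a..b}. f x y) = (LBINT y. LBINT x. ?h x y)"
    unfolding set_lebesgue_integral_def
    by (intro Bochner_Integration.integral_cong refl) (auto simp: indicator_def)
  also have "\<dots> = (LBINT x. LBINT y. ?h x y)"
    by (rule lborel_pair.Fubini_integral[OF int])
  also have "\<dots> = (LBINT x:{a..b}. LBINT y:{0..}. f x y)"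
    unfolding set_lebesgue_integral_def
    by (intro Bochner_Integration.integral_cong refl) (auto simp: indicator_def)
  finally show ?thesis .
qed

section \<open>The Fourier symbol as a function of time\<close>

text \<open>The energy \<open>(y')\<^sup>2 + \<rho>\<^sup>2 y\<^sup>2\<close> of a solution has derivative \<open>- 2 \<rho>\<^sup>2 (y')\<^sup>2\<close> and starts at \<open>1\<close>.
  This bounds the velocity for all \<open>\<rho>\<close> at once, with no distinction between the oscillating,
  critical and overdamped regimes.\<close>

lemma S1_hat_velocity_bounded:
  assumes "\<rho> \<ge> 0"
  obtains y' y'' where
    "\<And>t. ((\<lambda>t. S1_hat t \<rho>) has_real_derivative y' t) (at t)"
    "\<And>t. (y' has_real_derivative y'' t) (at t)"
    "\<And>t. y'' t = - \<rho>\<^sup>2 * y' t - \<rho>\<^sup>2 * S1_hat t \<rho>"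
    "S1_hat 0 \<rho> = 0" "y' 0 = 1"
    "\<And>t. t \<ge> 0 \<Longrightarrow> \<bar>y' t\<bar> \<le> 1"
proof -
  obtain y' y'' where y: "\<forall>t. ((\<lambda>t. S1_hat t \<rho>) has_real_derivative y' t) (at t)"
    "\<forall>t. (y' has_real_derivative y'' t) (at t)"
    "\<forall>t. y'' t + \<rho>\<^sup>2 * y' t + \<rho>\<^sup>2 * S1_hat t \<rho> = 0" "S1_hat 0 \<rho> = 0" "y' 0 = 1"
    using S1_hat_solves_ode[OF assms] by blast
  have y2: "y'' t = - \<rho>\<^sup>2 * y' t - \<rho>\<^sup>2 * S1_hat t \<rho>" for t
    using y(3)[rule_format, of t] by linarith
  \<comment> \<open>\<open>E\<close> is the energy of the damped oscillator; the damping term makes it decrease.\<close>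
  define E where "E t = (y' t)\<^sup>2 + \<rho>\<^sup>2 * (S1_hat t \<rho>)\<^sup>2" for t
  have dE: "(E has_real_derivative - 2 * \<rho>\<^sup>2 * (y' t)\<^sup>2) (at t)" for t
    unfolding E_def[abs_def]
    by (rule derivative_eq_intros y(1)[rule_format] y(2)[rule_format] refl)+
      (simp add: y2 power2_eq_square algebra_simps)
  have "\<bar>y' t\<bar> \<le> 1" if "t \<ge> 0" for t
  proof -
    have "E t \<le> E 0"
    proof (rule DERIV_nonpos_imp_nonincreasing[OF that])
      show "\<exists>d. (E has_real_derivative d) (at x) \<and> d \<le> 0" for x
        using dE[of x] by (intro exI[of _ "- 2 * \<rho>\<^sup>2 * (y' x)\<^sup>2"]) auto
    qed
    then have "(y' t)\<^sup>2 + \<rho>\<^sup>2 * (S1_hat t \<rho>)\<^sup>2 \<le> 1" using y(4,5) by (simp add: E_def)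
    moreover have "\<rho>\<^sup>2 * (S1_hat t \<rho>)\<^sup>2 \<ge> 0" by simp
    ultimately have "(y' t)\<^sup>2 \<le> 1" by linarith
    then show ?thesis by (simp add: abs_square_le_1)
  qed
  with y y2 show ?thesis by (intro that[of y' y'']) auto
qed

lemma S1_hat_Lipschitz:
  assumes "\<rho> \<ge> 0" "t \<ge> 0" "t' \<ge> 0"
  shows "\<bar>S1_hat t \<rho> - S1_hat t' \<rho>\<bar> \<le> \<bar>t - t'\<bar>"
proof -
  obtain y' where y: "\<And>t. ((\<lambda>t. S1_hat t \<rho>) has_real_derivative y' t) (at t)"
    "\<And>t. t \<ge> 0 \<Longrightarrow> \<bar>y' t\<bar> \<le> 1"
    using S1_hat_velocity_bounded[OF assms(1)] by metis
  have "norm (S1_hat t \<rho> - S1_hat t' \<rho>) \<le> 1 * norm (t - t')"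
    by (rule field_differentiable_bound[of "{0..}" _ y'])
      (use y assms in \<open>auto intro: has_field_derivative_at_within\<close>)
  then show ?thesis by simp
qed

lemma S1_hat_abs_le:
  assumes "\<rho> \<ge> 0" "t \<ge> 0"
  shows "\<bar>S1_hat t \<rho>\<bar> \<le> t"
proof -
  have "S1_hat 0 \<rho> = 0" using S1_hat_velocity_bounded[OF assms(1)] by metis
  then show ?thesis using S1_hat_Lipschitz[OF assms(1,2), of 0] assms by simp
qed

lemma S1_hat_measurable [measurable]:
  "(\<lambda>x. S1_hat (fst x) (snd x)) \<in> borel_measurable (borel \<Otimes>\<^sub>M borel)"
  unfolding S1_hat_def omega_def lambda_plus_def lambda_minus_def by measurable

lemma S1_hat_measurable' [measurable (raw)]:
  assumes [measurable]: "f \<in> borel_measurable M" "g \<in> borel_measurable M"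
  shows "(\<lambda>x. S1_hat (f x) (g x)) \<in> borel_measurable M"
  using measurable_compose[OF _ S1_hat_measurable, of "\<lambda>x. (f x, g x)" M] by simp

text \<open>The Laplace transform turns the equation \<open>y'' + \<rho>\<^sup>2 y' + \<rho>\<^sup>2 y = 0\<close> with data \<open>y 0 = 0\<close>,
  \<open>y' 0 = 1\<close> into an algebraic one.\<close>

lemma S1_hat_laplace:
  assumes "\<rho> \<ge> 0" "s > 0"
  shows "set_integrable lborel {0..} (\<lambda>t. exp (- s * t) * S1_hat t \<rho>)"
    and "(LBINT t:{0..}. exp (- s * t) * S1_hat t \<rho>) = 1 / (s\<^sup>2 + s * \<rho>\<^sup>2 + \<rho>\<^sup>2)"
proof -
  obtain y' y'' where y: "\<And>t. ((\<lambda>t. S1_hat t \<rho>) has_real_derivative y' t) (at t)"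
    "\<And>t. (y' has_real_derivative y'' t) (at t)"
    "\<And>t. y'' t = - \<rho>\<^sup>2 * y' t - \<rho>\<^sup>2 * S1_hat t \<rho>"
    "S1_hat 0 \<rho> = 0" "y' 0 = 1"
    "\<And>t. t \<ge> 0 \<Longrightarrow> \<bar>y' t\<bar> \<le> 1"
    using S1_hat_velocity_bounded[OF assms(1)] by metis
  define D where "D = s\<^sup>2 + s * \<rho>\<^sup>2 + \<rho>\<^sup>2"
  have "D > 0" using assms by (simp add: D_def add_pos_nonneg)
  show int: "set_integrable lborel {0..} (\<lambda>t. exp (- s * t) * S1_hat t \<rho>)"
    unfolding set_integrable_def
  proof (rule Bochner_Integration.integrable_bound[OF set_integrable_exp_mult[OF assms(2), of 0, unfolded set_integrable_def]])
    show "AE x in lborel. norm (indicator {0..} x *\<^sub>R (exp (- s * x) * S1_hat x \<rho>))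
      \<le> norm (indicator {0..} x *\<^sub>R ((0 + x) * exp (- s * x)))"
      using S1_hat_abs_le[OF assms(1)] by (auto simp: indicator_def abs_mult)
  qed simp
  \<comment> \<open>Multiplying the equation by \<open>exp (- s * t)\<close> and collecting total derivatives yields this
    primitive; \<open>F 0 = - 1 / D\<close> comes from the initial data.\<close>
  define F where "F t = - (exp (- s * t) * (y' t + (s + \<rho>\<^sup>2) * S1_hat t \<rho>)) / D" for t
  have "(LBINT t:{0..}. exp (- s * t) * S1_hat t \<rho>) = 0 - F 0"
  proof (rule LBINT_FTC_atLeast[OF int])
    show "(F has_real_derivative exp (- s * x) * S1_hat x \<rho>) (at x)" for x
    proof -
      have "((\<lambda>t. exp (- s * t) * (y' t + (s + \<rho>\<^sup>2) * S1_hat t \<rho>)) has_real_derivative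
          - (D * (exp (- s * x) * S1_hat x \<rho>))) (at x)"
        by (rule derivative_eq_intros y(1,2) refl)+
          (simp add: y(3) D_def algebra_simps power2_eq_square)
      from DERIV_cmult[OF this, of "- 1 / D"] show ?thesis
        using \<open>D > 0\<close> by (simp add: F_def[abs_def])
    qed
    show "continuous_on {0..} (\<lambda>t. exp (- s * t) * S1_hat t \<rho>)"
      by (intro continuous_intros DERIV_continuous_on[OF has_field_derivative_at_within[OF y(1)]])
    show "(F \<longlongrightarrow> 0) at_top"
    proof (rule Lim_null_comparison)
      show "\<forall>\<^sub>F t in at_top. norm (F t) \<le> exp (- s * t) * (1 + (s + \<rho>\<^sup>2) * t) / D"
      proof (rule eventually_mono[OF eventually_ge_at_top[of 0]])
        fix t :: real assume t: "t \<ge> 0"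
        have "\<bar>y' t + (s + \<rho>\<^sup>2) * S1_hat t \<rho>\<bar> \<le> \<bar>y' t\<bar> + \<bar>(s + \<rho>\<^sup>2) * S1_hat t \<rho>\<bar>"
          by (rule abs_triangle_ineq)
        also have "\<dots> \<le> 1 + (s + \<rho>\<^sup>2) * t"
          using y(6)[OF t] S1_hat_abs_le[OF assms(1) t] assms
          by (intro add_mono) (auto simp: abs_mult intro!: mult_mono)
        finally show "norm (F t) \<le> exp (- s * t) * (1 + (s + \<rho>\<^sup>2) * t) / D"
          using \<open>D > 0\<close> by (simp add: F_def abs_mult divide_right_mono)
      qed
      have "((\<lambda>t. exp (- s * t) * (1 + c * t)) \<longlongrightarrow> 0) at_top" for c
        using assms by real_asymp
      from tendsto_divide[OF this[of "s + \<rho>\<^sup>2"] tendsto_const[of D]]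
      show "((\<lambda>t. exp (- s * t) * (1 + (s + \<rho>\<^sup>2) * t) / D) \<longlongrightarrow> 0) at_top"
        using \<open>D > 0\<close> by simp
    qed
  qed
  then show "(LBINT t:{0..}. exp (- s * t) * S1_hat t \<rho>) = 1 / (s\<^sup>2 + s * \<rho>\<^sup>2 + \<rho>\<^sup>2)"
    by (simp add: F_def y D_def)
qed

section \<open>Convergence of the inversion integral, uniformly in time\<close>

text \<open>By the second mean value theorem a bounded monotone factor worsens a bound on the integrals
  over all subintervals only by the factor \<open>2 * K\<close>. Hypothesis and conclusion have the same form,
  so that several monotone factors can be absorbed one after another.\<close>

lemma monotone_multiplier_integral_bound:
  fixes g h :: "real \<Rightarrow> real"
  assumes h: "h integrable_on {a..b}"
    and M: "\<And>c d. a \<le> c \<Longrightarrow> c \<le> d \<Longrightarrow> d \<le> b \<Longrightarrow> \<bar>integral {c..d} h\<bar> \<le> M"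
    and g: "(\<forall>x y. a \<le> x \<longrightarrow> x \<le> y \<longrightarrow> y \<le> b \<longrightarrow> g x \<le> g y) \<or> (\<forall>x y. a \<le> x \<longrightarrow> x \<le> y \<longrightarrow> y \<le> b \<longrightarrow> g y \<le> g x)"
    and K: "\<And>x. a \<le> x \<Longrightarrow> x \<le> b \<Longrightarrow> 0 \<le> g x \<and> g x \<le> K"
    and cd: "a \<le> c" "c \<le> d" "d \<le> b"
  shows "(\<lambda>x. g x * h x) integrable_on {c..d}"
    and "\<bar>integral {c..d} (\<lambda>x. g x * h x)\<bar> \<le> 2 * K * M"
proof -
  have hi: "h integrable_on {c..d}"
    using h cd by (auto intro: integrable_on_subinterval)
  have "\<exists>e\<in>{c..d}. ((\<lambda>x. g x * h x) has_integral (g c * integral {c..e} h + g d * integral {e..d} h)) {c..d}"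
    using g
  proof
    assume "\<forall>x y. a \<le> x \<longrightarrow> x \<le> y \<longrightarrow> y \<le> b \<longrightarrow> g x \<le> g y"
    with cd have "\<And>x y. \<lbrakk>c \<le> x; x \<le> y; y \<le> d\<rbrakk> \<Longrightarrow> g x \<le> g y" by force
    then obtain e where
      "e \<in> {c..d}" "((\<lambda>x. g x * h x) has_integral (g c * integral {c..e} h + g d * integral {e..d} h)) {c..d}"
      by (rule second_mean_value_theorem_full[OF hi cd(2), where g = g])
    then show ?thesis by blast
  next
    assume "\<forall>x y. a \<le> x \<longrightarrow> x \<le> y \<longrightarrow> y \<le> b \<longrightarrow> g y \<le> g x"
    with cd have "\<And>x y. \<lbrakk>c \<le> x; x \<le> y; y \<le> d\<rbrakk> \<Longrightarrow> - g x \<le> - g y" by force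
    then obtain e where
      e: "e \<in> {c..d}" "((\<lambda>x. - g x * h x) has_integral (- g c * integral {c..e} h + - g d * integral {e..d} h)) {c..d}"
      by (rule second_mean_value_theorem_full[OF hi cd(2), where g = "\<lambda>x. - g x"])
    have "((\<lambda>x. g x * h x) has_integral (g c * integral {c..e} h + g d * integral {e..d} h)) {c..d}"
      using has_integral_neg[OF e(2)] by (simp add: add.commute)
    with e(1) show ?thesis by blast
  qed
  then obtain e where e: "e \<in> {c..d}"
    "((\<lambda>x. g x * h x) has_integral (g c * integral {c..e} h + g d * integral {e..d} h)) {c..d}" by blast
  then show "(\<lambda>x. g x * h x) integrable_on {c..d}" by blast
  have "integral {c..d} (\<lambda>x. g x * h x) = g c * integral {c..e} h + g d * integral {e..d} h"
    using e(2) by (rule integral_unique)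
  also have "\<bar>\<dots>\<bar> \<le> \<bar>g c\<bar> * \<bar>integral {c..e} h\<bar> + \<bar>g d\<bar> * \<bar>integral {e..d} h\<bar>"
    by (metis abs_mult abs_triangle_ineq)
  also have "\<dots> \<le> K * M + K * M"
    using K[of c] K[of d] M[of c e] M[of e d] e(1) cd by (intro add_mono mult_mono) auto
  finally show "\<bar>integral {c..d} (\<lambda>x. g x * h x)\<bar> \<le> 2 * K * M" by simp
qed

lemma sin_integral_bound:
  fixes r :: real
  assumes "r > 0" "c \<le> d"
  shows "\<bar>integral {c..d} (\<lambda>x. sin (r * x))\<bar> \<le> 2 / r"
proof -
  have "((\<lambda>x. sin (r * x)) has_integral (- cos (r * d) / r - - cos (r * c) / r)) {c..d}"
    by (rule fundamental_theorem_of_calculus[OF assms(2)])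
      (use assms in \<open>auto intro!: derivative_eq_intros simp flip: has_real_derivative_iff_has_vector_derivative\<close>)
  then have "integral {c..d} (\<lambda>x. sin (r * x)) = (cos (r * c) - cos (r * d)) / r"
    by (simp add: integral_unique diff_divide_distrib)
  moreover have "\<bar>cos (r * c) - cos (r * d)\<bar> \<le> 2"
    using abs_cos_le_one[of "r * c"] abs_cos_le_one[of "r * d"] by linarith
  ultimately show ?thesis using assms by (simp add: divide_right_mono)
qed

lemma lambda_plus_mono:
  assumes "2 \<le> x" "x \<le> y"
  shows "lambda_plus x \<le> lambda_plus y"
proof -
  \<comment> \<open>In this form, free of cancellation, monotonicity can be read off.\<close>
  have eq: "lambda_plus z = - 2 * z / (z + sqrt (z\<^sup>2 - 4))" if "z \<ge> 2" for z
  proof -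
    have "z\<^sup>2 \<ge> 2\<^sup>2" using that by (intro power_mono) auto
    then have "(z - sqrt (z\<^sup>2 - 4)) * (z + sqrt (z\<^sup>2 - 4)) = 4"
      by (simp add: algebra_simps flip: power2_eq_square)
    moreover have "z + sqrt (z\<^sup>2 - 4) > 0" using that \<open>z\<^sup>2 \<ge> 2\<^sup>2\<close> by (intro add_pos_nonneg) auto
    ultimately have "z - sqrt (z\<^sup>2 - 4) = 4 / (z + sqrt (z\<^sup>2 - 4))" by (simp add: field_simps)
    moreover have "lambda_plus z = - z * (z - sqrt (z\<^sup>2 - 4)) / 2"
      by (simp add: lambda_plus_def algebra_simps power2_eq_square)
    ultimately have "lambda_plus z = - z * (4 / (z + sqrt (z\<^sup>2 - 4))) / 2" by simp
    also have "\<dots> = - 2 * z / (z + sqrt (z\<^sup>2 - 4))" by (simp add: field_split_simps)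
    finally show ?thesis .
  qed
  have sq: "2\<^sup>2 \<le> x\<^sup>2" "x\<^sup>2 \<le> y\<^sup>2" using assms by (intro power_mono; simp)+
  then have y4: "y\<^sup>2 - 4 \<ge> 0" using order_trans[OF sq] by simp
  have "(y * sqrt (x\<^sup>2 - 4))\<^sup>2 \<le> (x * sqrt (y\<^sup>2 - 4))\<^sup>2"
    using sq by (simp add: power_mult_distrib algebra_simps)
  then have "y * sqrt (x\<^sup>2 - 4) \<le> x * sqrt (y\<^sup>2 - 4)"
    by (rule power2_le_imp_le) (use assms y4 in auto)
  moreover have "x + sqrt (x\<^sup>2 - 4) > 0" "y + sqrt (y\<^sup>2 - 4) > 0"
    using assms sq y4 by (auto intro!: add_pos_nonneg)
  ultimately show ?thesis
    using assms by (simp add: eq divide_simps) (simp add: algebra_simps)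
qed

lemma lambda_minus_antimono:
  assumes "2 \<le> x" "x \<le> y"
  shows "lambda_minus y \<le> lambda_minus x"
proof -
  have "2\<^sup>2 \<le> x\<^sup>2" "x\<^sup>2 \<le> y\<^sup>2" using assms by (intro power_mono; simp)+
  then have "x\<^sup>2 + x * sqrt (x\<^sup>2 - 4) \<le> y\<^sup>2 + y * sqrt (y\<^sup>2 - 4)"
    using assms by (intro add_mono mult_mono) auto
  then show ?thesis by (simp add: lambda_minus_def)
qed

lemma lambda_nonpos:
  assumes "2 \<le> x"
  shows "lambda_plus x \<le> 0" "lambda_minus x \<le> 0"
proof -
  have "2\<^sup>2 \<le> x\<^sup>2" using assms by (intro power_mono; simp)
  have "sqrt (x\<^sup>2 - 4) \<le> x" using assms by (intro real_le_lsqrt) auto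
  then have "x * sqrt (x\<^sup>2 - 4) \<le> x\<^sup>2" using assms unfolding power2_eq_square by (intro mult_left_mono) auto
  moreover have "x * sqrt (x\<^sup>2 - 4) \<ge> 0"
    using assms \<open>2\<^sup>2 \<le> x\<^sup>2\<close> by (intro mult_nonneg_nonneg real_sqrt_ge_zero) auto
  ultimately have "(- x\<^sup>2 + x * sqrt (x\<^sup>2 - 4)) / 2 \<le> 0" "(- x\<^sup>2 - x * sqrt (x\<^sup>2 - 4)) / 2 \<le> 0"
    by simp_all
  then show "lambda_plus x \<le> 0" "lambda_minus x \<le> 0"
    by (simp_all add: lambda_plus_def lambda_minus_def)
qed

text \<open>For \<open>\<rho> > 2\<close> the amplitude \<open>\<rho> * S1_hat t \<rho>\<close> equals
  \<open>(exp (lambda_plus \<rho> * t) - exp (lambda_minus \<rho> * t)) / sqrt (\<rho>\<^sup>2 - 4)\<close>. Each of the two terms is a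
  product of two monotone factors, the exponential being at most \<open>1\<close>, so the second mean value
  theorem applies twice to each. The resulting bound does not involve \<open>t\<close>; this uniformity yields
  both the continuity of \<open>G1\<close> in \<open>t\<close> and its Laplace transform.\<close>

lemma oscillatory_tail_bound:
  assumes r: "r > 0" and t: "t \<ge> 0" and A: "2 < A" "A \<le> B"
  shows "\<bar>integral {A..B} (\<lambda>\<rho>. S1_hat t \<rho> * \<rho> * sin (r * \<rho>))\<bar> \<le> 16 / (r * sqrt (A\<^sup>2 - 4))"
proof -
  define w where "w = (\<lambda>\<rho>::real. 1 / sqrt (\<rho>\<^sup>2 - 4))"
  define K where "K = w A"
  have A4: "A\<^sup>2 > 4" using power_strict_mono[OF A(1), of 2] by simp
  have gt: "x\<^sup>2 - 4 \<ge> A\<^sup>2 - 4" if "A \<le> x" for x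
    using power_mono[OF that, of 2] A by simp
  have w0: "0 \<le> w x" if "A \<le> x" for x using gt[OF that] A4 by (simp add: w_def)
  have w_anti: "w y \<le> w x" if "A \<le> x" "x \<le> y" for x y
  proof -
    have "x\<^sup>2 \<le> y\<^sup>2" using that A by (intro power_mono) auto
    then show ?thesis using gt[OF that(1)] A4 unfolding w_def by (intro divide_left_mono) auto
  qed
  have si: "(\<lambda>x. sin (r * x)) integrable_on {A..B}"
    by (intro integrable_continuous_interval continuous_intros)
  note 1 = monotone_multiplier_integral_bound[where K = K and g = w, OF si sin_integral_bound[OF r]]
  have wa: "(\<forall>x y. A \<le> x \<longrightarrow> x \<le> y \<longrightarrow> y \<le> B \<longrightarrow> w x \<le> w y) \<or> (\<forall>x y. A \<le> x \<longrightarrow> x \<le> y \<longrightarrow> y \<le> B \<longrightarrow> w y \<le> w x)"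
    using w_anti by blast
  have wK: "0 \<le> w x \<and> w x \<le> K" if "A \<le> x" for x
    using w0[OF that] w_anti[OF _ that] by (simp add: K_def)
  \<comment> \<open>The weight \<open>w\<close> gains the factor \<open>2 * w A\<close>; each exponential then costs one more factor \<open>2\<close>.\<close>
  have 2: "(\<lambda>x. w x * sin (r * x)) integrable_on {A..B}"
    using 1(1)[OF _ wa] wK A by auto
  have 3: "\<bar>integral {c..d} (\<lambda>x. w x * sin (r * x))\<bar> \<le> 2 * K * (2 / r)" if "A \<le> c" "c \<le> d" "d \<le> B" for c d
    using 1(2)[OF _ wa _ that] wK by auto
  have p: "(\<lambda>x. exp (lambda_plus x * t) * (w x * sin (r * x))) integrable_on {A..B}"
     "\<bar>integral {A..B} (\<lambda>x. exp (lambda_plus x * t) * (w x * sin (r * x)))\<bar> \<le> 2 * 1 * (2 * K * (2 / r))"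
  proof -
    have a: "(\<forall>x y. A \<le> x \<longrightarrow> x \<le> y \<longrightarrow> y \<le> B \<longrightarrow> exp (lambda_plus x * t) \<le> exp (lambda_plus y * t))"
      using A t lambda_plus_mono by (auto intro!: mult_right_mono)
    have b: "0 \<le> exp (lambda_plus x * t) \<and> exp (lambda_plus x * t) \<le> 1" if "A \<le> x" for x
      using lambda_nonpos(1)[of x] that A t by (auto simp: mult_nonpos_nonneg)
    from monotone_multiplier_integral_bound[where K=1 and g="\<lambda>x. exp (lambda_plus x * t)", OF 2 3 disjI1[OF a] b, of A B] A
    show "(\<lambda>x. exp (lambda_plus x * t) * (w x * sin (r * x))) integrable_on {A..B}"
     "\<bar>integral {A..B} (\<lambda>x. exp (lambda_plus x * t) * (w x * sin (r * x)))\<bar> \<le> 2 * 1 * (2 * K * (2 / r))"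
      by auto
  qed
  have m: "(\<lambda>x. exp (lambda_minus x * t) * (w x * sin (r * x))) integrable_on {A..B}"
     "\<bar>integral {A..B} (\<lambda>x. exp (lambda_minus x * t) * (w x * sin (r * x)))\<bar> \<le> 2 * 1 * (2 * K * (2 / r))"
  proof -
    have a: "(\<forall>x y. A \<le> x \<longrightarrow> x \<le> y \<longrightarrow> y \<le> B \<longrightarrow> exp (lambda_minus y * t) \<le> exp (lambda_minus x * t))"
      using A t lambda_minus_antimono by (auto intro!: mult_right_mono)
    have b: "0 \<le> exp (lambda_minus x * t) \<and> exp (lambda_minus x * t) \<le> 1" if "A \<le> x" for x
      using lambda_nonpos(2)[of x] that A t by (auto simp: mult_nonpos_nonneg)
    from monotone_multiplier_integral_bound[where K=1 and g="\<lambda>x. exp (lambda_minus x * t)", OF 2 3 disjI2[OF a] b, of A B] A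
    show "(\<lambda>x. exp (lambda_minus x * t) * (w x * sin (r * x))) integrable_on {A..B}"
     "\<bar>integral {A..B} (\<lambda>x. exp (lambda_minus x * t) * (w x * sin (r * x)))\<bar> \<le> 2 * 1 * (2 * K * (2 / r))"
      by auto
  qed
  have "integral {A..B} (\<lambda>\<rho>. S1_hat t \<rho> * \<rho> * sin (r * \<rho>))
     = integral {A..B} (\<lambda>x. exp (lambda_plus x * t) * (w x * sin (r * x)) - exp (lambda_minus x * t) * (w x * sin (r * x)))"
  proof (rule integral_cong)
    fix x assume "x \<in> {A..B}"
    then have "A \<le> x" by simp
    then have "x > 2" "x\<^sup>2 - 4 > 0" using A(1) gt[of x] A4 by linarith+
    moreover have "lambda_plus x - lambda_minus x = x * sqrt (x\<^sup>2 - 4)"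
      by (simp add: lambda_plus_def lambda_minus_def field_simps)
    ultimately show "S1_hat t x * x * sin (r * x) = exp (lambda_plus x * t) * (w x * sin (r * x)) - exp (lambda_minus x * t) * (w x * sin (r * x))"
      by (simp add: S1_hat_def w_def field_simps)
  qed
  also have "\<dots> = integral {A..B} (\<lambda>x. exp (lambda_plus x * t) * (w x * sin (r * x))) - integral {A..B} (\<lambda>x. exp (lambda_minus x * t) * (w x * sin (r * x)))"
    by (rule Henstock_Kurzweil_Integration.integral_diff[OF p(1) m(1)])
  also have "\<bar>\<dots>\<bar> \<le> 16 * K / r"
    using p(2) m(2) by (simp add: abs_le_iff)
  also have "16 * K / r = 16 / (r * sqrt (A\<^sup>2 - 4))" by (simp add: K_def w_def)
  finally show ?thesis .
qed

lemma G1_integrand_integrable: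
  assumes "t \<ge> 0" "a \<ge> 0"
  shows "set_integrable lborel {a..R} (\<lambda>\<rho>. S1_hat t \<rho> * \<rho> * sin (r * \<rho>))"
proof (cases "R \<ge> 0")
  case True
  show ?thesis
    unfolding set_integrable_def
  proof (rule Bochner_Integration.integrable_bound)
    show "integrable lborel (\<lambda>x. indicator {a..R} x *\<^sub>R (t * R))"
      by (rule borel_integrable_atLeastAtMost'[unfolded set_integrable_def]) auto
    have "\<bar>S1_hat t x * x * sin (r * x)\<bar> \<le> t * R" if "a \<le> x" "x \<le> R" for x
    proof -
      have "\<bar>S1_hat t x * x * sin (r * x)\<bar> = \<bar>S1_hat t x\<bar> * \<bar>x\<bar> * \<bar>sin (r * x)\<bar>" by (simp add: abs_mult)
      also have "\<dots> \<le> t * R * 1"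
        using S1_hat_abs_le[of x t] assms that by (intro mult_mono) auto
      finally show ?thesis by simp
    qed
    then show "AE x in lborel. norm (indicator {a..R} x *\<^sub>R (S1_hat t x * x * sin (r * x)))
        \<le> norm (indicator {a..R} x *\<^sub>R (t * R))"
      using assms True by (auto simp: indicator_def)
  qed simp
next
  case False
  then have "{a..R} = {}" using assms by auto
  then show ?thesis by (simp add: set_integrable_def)
qed

lemma G1_trunc_HK:
  assumes "t \<ge> 0"
  shows "G1_trunc t r R = 1 / (2 * pi\<^sup>2 * r) * integral {0..R} (\<lambda>\<rho>. S1_hat t \<rho> * \<rho> * sin (r * \<rho>))"
  unfolding G1_trunc_def using set_borel_integral_eq_integral(2)[OF G1_integrand_integrable[OF assms, of 0 R r]] by simp

lemma G1_trunc_Cauchy: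
  assumes r: "r > 0" and t: "t \<ge> 0" and A: "2 < A" "A \<le> B"
  shows "\<bar>G1_trunc t r B - G1_trunc t r A\<bar> \<le> 8 / (pi\<^sup>2 * r\<^sup>2 * sqrt (A\<^sup>2 - 4))"
proof -
  let ?f = "\<lambda>\<rho>. S1_hat t \<rho> * \<rho> * sin (r * \<rho>)"
  have "?f integrable_on {0..B}"
    using set_borel_integral_eq_integral(1)[OF G1_integrand_integrable[OF t]] by simp
  then have "integral {0..A} ?f + integral {A..B} ?f = integral {0..B} ?f"
    using A by (intro Henstock_Kurzweil_Integration.integral_combine) auto
  then have "G1_trunc t r B - G1_trunc t r A = 1 / (2 * pi\<^sup>2 * r) * integral {A..B} ?f"
    unfolding G1_trunc_HK[OF t] right_diff_distrib[symmetric] by simp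
  also have "\<bar>\<dots>\<bar> \<le> 1 / (2 * pi\<^sup>2 * r) * (16 / (r * sqrt (A\<^sup>2 - 4)))"
    using oscillatory_tail_bound[OF r t A] r
    unfolding abs_mult by (intro mult_mono) auto
  also have "\<dots> = 8 / (pi\<^sup>2 * r\<^sup>2 * sqrt (A\<^sup>2 - 4))" by (simp add: power2_eq_square)
  finally show ?thesis .
qed

text \<open>Besides the limit, the criterion provides the rate at which it is approached.\<close>

lemma real_Cauchy_criterion_at_top:
  fixes f \<epsilon> :: "real \<Rightarrow> real"
  assumes C: "\<And>A B. N < A \<Longrightarrow> A \<le> B \<Longrightarrow> \<bar>f B - f A\<bar> \<le> \<epsilon> A" and \<epsilon>: "(\<epsilon> \<longlongrightarrow> 0) at_top"
  obtains L where "(f \<longlongrightarrow> L) at_top" "\<And>A. N < A \<Longrightarrow> \<bar>L - f A\<bar> \<le> \<epsilon> A"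
proof -
  have "Cauchy (\<lambda>n::nat. f (real n))"
  proof (rule CauchyI)
    fix e :: real assume "e > 0"
    then have "\<forall>\<^sub>F A in at_top. \<bar>\<epsilon> A\<bar> < e / 2 \<and> A > N"
      using tendstoD[OF \<epsilon>, of "e/2"] eventually_gt_at_top[of N] by (auto simp: eventually_conj_iff)
    then obtain A where A: "\<bar>\<epsilon> A\<bar> < e / 2" "A > N" using eventually_happens'[OF trivial_limit_at_top_linorder] by blast
    obtain M where M: "real M \<ge> A" using real_arch_simple by blast
    show "\<exists>M. \<forall>m\<ge>M. \<forall>n\<ge>M. norm (f (real m) - f (real n)) < e"
    proof (intro exI[of _ M] allI impI)
      fix m n assume mn: "M \<le> m" "M \<le> n"
      have "\<bar>f (real m) - f A\<bar> \<le> \<epsilon> A" "\<bar>f (real n) - f A\<bar> \<le> \<epsilon> A"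
        using C[OF A(2)] M mn by auto
      then show "norm (f (real m) - f (real n)) < e" using A(1) by simp
    qed
  qed
  then obtain L where L: "(\<lambda>n. f (real n)) \<longlonglongrightarrow> L"
    using Cauchy_convergent_iff convergent_def by blast
  have 1: "\<bar>L - f A\<bar> \<le> \<epsilon> A" if "N < A" for A
  proof (rule tendsto_upperbound)
    show "(\<lambda>n. \<bar>f (real n) - f A\<bar>) \<longlonglongrightarrow> \<bar>L - f A\<bar>" by (intro tendsto_intros L)
    obtain M where M: "real M \<ge> A" using real_arch_simple by blast
    show "\<forall>\<^sub>F n in sequentially. \<bar>f (real n) - f A\<bar> \<le> \<epsilon> A"
      using eventually_ge_at_top[of M] by eventually_elim (use M C[OF that] in auto)
  qed simp
  have "((\<lambda>A. f A - L) \<longlongrightarrow> 0) at_top"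
  proof (rule Lim_null_comparison[OF _ \<epsilon>])
    show "\<forall>\<^sub>F A in at_top. norm (f A - L) \<le> \<epsilon> A"
      using eventually_gt_at_top[of N] by eventually_elim (use 1 in \<open>auto simp: abs_minus_commute\<close>)
  qed
  then have "(f \<longlongrightarrow> L) at_top" using LIM_zero_cancel by blast
  with 1 show ?thesis using that by blast
qed

lemma G1_trunc_tendsto_uniformly:
  assumes r: "r > 0" and t: "t \<ge> 0"
  shows "(G1_trunc t r \<longlongrightarrow> G1 t r) at_top"
    and "\<And>A. 2 < A \<Longrightarrow> \<bar>G1 t r - G1_trunc t r A\<bar> \<le> 8 / (pi\<^sup>2 * r\<^sup>2 * sqrt (A\<^sup>2 - 4))"
proof -
  have "pi\<^sup>2 * r\<^sup>2 > 0" using r by simp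
  have "((\<lambda>A. 8 / (c * sqrt (A\<^sup>2 - 4))) \<longlongrightarrow> 0) at_top" if "c > 0" for c :: real
    using that by real_asymp
  from this[OF \<open>pi\<^sup>2 * r\<^sup>2 > 0\<close>] obtain L where L: "(G1_trunc t r \<longlongrightarrow> L) at_top"
     "\<And>A. 2 < A \<Longrightarrow> \<bar>L - G1_trunc t r A\<bar> \<le> 8 / (pi\<^sup>2 * r\<^sup>2 * sqrt (A\<^sup>2 - 4))"
    using real_Cauchy_criterion_at_top[of 2 "G1_trunc t r" "\<lambda>A. 8 / (pi\<^sup>2 * r\<^sup>2 * sqrt (A\<^sup>2 - 4))"]
      G1_trunc_Cauchy[OF r t] by blast
  have "G1 t r = L" unfolding G1_def using L(1) by (intro tendsto_Lim) auto
  with L show "(G1_trunc t r \<longlongrightarrow> G1 t r) at_top"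
    and "\<And>A. 2 < A \<Longrightarrow> \<bar>G1 t r - G1_trunc t r A\<bar> \<le> 8 / (pi\<^sup>2 * r\<^sup>2 * sqrt (A\<^sup>2 - 4))" by auto
qed

lemma G1_trunc_Lipschitz:
  assumes r: "r > 0" and R: "R \<ge> 0" and t: "t \<ge> 0" "t' \<ge> 0"
  shows "\<bar>G1_trunc t r R - G1_trunc t' r R\<bar> \<le> R\<^sup>2 / (2 * pi\<^sup>2 * r) * \<bar>t - t'\<bar>"
proof -
  let ?f = "\<lambda>t \<rho>. S1_hat t \<rho> * \<rho> * sin (r * \<rho>)"
  have i: "?f s integrable_on {0..R}" if "s \<ge> 0" for s
    using set_borel_integral_eq_integral(1)[OF G1_integrand_integrable[OF that]] by simp
  define I where "I = integral {0..R} (\<lambda>\<rho>. ?f t \<rho> - ?f t' \<rho>)"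
  have "\<bar>I\<bar> \<le> integral {0..R} (\<lambda>\<rho>. \<bar>t - t'\<bar> * R)"
    unfolding I_def real_norm_def[symmetric]
  proof (rule integral_norm_bound_integral)
    show "(\<lambda>\<rho>. ?f t \<rho> - ?f t' \<rho>) integrable_on {0..R}"
      by (intro Henstock_Kurzweil_Integration.integrable_diff i t)
    show "(\<lambda>\<rho>. norm (t - t') * R) integrable_on {0..R}"
      by (intro integrable_continuous_interval continuous_intros)
    fix x assume x: "x \<in> {0..R}"
    have "?f t x - ?f t' x = (S1_hat t x - S1_hat t' x) * x * sin (r * x)"
      by (simp only: left_diff_distrib)
    then have "norm (?f t x - ?f t' x) = \<bar>S1_hat t x - S1_hat t' x\<bar> * \<bar>x\<bar> * \<bar>sin (r * x)\<bar>"
      by (simp only: abs_mult real_norm_def)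
    also have "\<dots> \<le> \<bar>t - t'\<bar> * R * 1"
      using S1_hat_Lipschitz[of x t t'] x t by (intro mult_mono) auto
    finally show "norm (?f t x - ?f t' x) \<le> norm (t - t') * R" by simp
  qed
  also have "\<dots> = R\<^sup>2 * \<bar>t - t'\<bar>"
    using R by (simp add: power2_eq_square)
  finally have I: "\<bar>I\<bar> \<le> R\<^sup>2 * \<bar>t - t'\<bar>" .
  have "G1_trunc t r R - G1_trunc t' r R = 1 / (2 * pi\<^sup>2 * r) * I"
    unfolding G1_trunc_HK[OF t(1)] G1_trunc_HK[OF t(2)] I_def
    by (subst Henstock_Kurzweil_Integration.integral_diff[OF i[OF t(1)] i[OF t(2)]]) (simp only: right_diff_distrib)
  then have "\<bar>G1_trunc t r R - G1_trunc t' r R\<bar> = 1 / (2 * pi\<^sup>2 * r) * \<bar>I\<bar>"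
    using r by (simp add: abs_mult)
  also have "\<dots> \<le> 1 / (2 * pi\<^sup>2 * r) * (R\<^sup>2 * \<bar>t - t'\<bar>)"
    using I r by (intro mult_left_mono) auto
  finally show ?thesis by simp
qed

text \<open>A uniform limit of Lipschitz functions; the rate in \<open>G1_trunc_tendsto_uniformly\<close> is the same
  for all \<open>t \<ge> 0\<close>.\<close>

lemma G1_continuous_on:
  assumes r: "r > 0"
  shows "continuous_on {0..} (\<lambda>t. G1 t r)"
proof (rule uniform_limit_theorem[where F = at_top and f = "\<lambda>R t. G1_trunc t r R"])
  show "\<forall>\<^sub>F R in at_top. continuous_on {0..} (\<lambda>t. G1_trunc t r R)"
    using eventually_ge_at_top[of 0]
  proof eventually_elim
    case (elim R)
    have "(R\<^sup>2 / (2 * pi\<^sup>2 * r))-lipschitz_on {0..} (\<lambda>t. G1_trunc t r R)"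
      using G1_trunc_Lipschitz[OF r elim] r by (intro lipschitz_onI) (auto simp: dist_real_def)
    then show ?case by (rule lipschitz_on_continuous_on)
  qed
  show "uniform_limit {0..} (\<lambda>R t. G1_trunc t r R) (\<lambda>t. G1 t r) at_top"
  proof (rule uniform_limitI)
    fix e :: real assume "e > 0"
    have "pi\<^sup>2 * r\<^sup>2 > 0" using r by simp
    have "((\<lambda>A. 8 / (c * sqrt (A\<^sup>2 - 4))) \<longlongrightarrow> 0) at_top" if "c > 0" for c :: real
      using that by real_asymp
    from tendstoD[OF this[OF \<open>pi\<^sup>2 * r\<^sup>2 > 0\<close>] \<open>e > 0\<close>]
    have "\<forall>\<^sub>F A in at_top. 8 / (pi\<^sup>2 * r\<^sup>2 * sqrt (A\<^sup>2 - 4)) < e"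
      unfolding dist_real_def diff_0_right by (elim eventually_mono) (rule le_less_trans[OF abs_ge_self])
    then show "\<forall>\<^sub>F A in at_top. \<forall>t\<in>{0..}. dist (G1_trunc t r A) (G1 t r) < e"
      using eventually_gt_at_top[of 2]
    proof eventually_elim
      case (elim A)
      show ?case
      proof
        fix t :: real assume "t \<in> {0..}"
        then have "\<bar>G1 t r - G1_trunc t r A\<bar> \<le> 8 / (pi\<^sup>2 * r\<^sup>2 * sqrt (A\<^sup>2 - 4))"
          using G1_trunc_tendsto_uniformly(2)[OF r] elim(2) by simp
        then show "dist (G1_trunc t r A) (G1 t r) < e"
          using elim(1) by (simp add: dist_real_def abs_minus_commute)
      qed
    qed
  qed
qed simp

text \<open>The part over \<open>\<rho> \<le> 3\<close> grows at most linearly because \<open>\<bar>S1_hat t \<rho>\<bar> \<le> t\<close>, and the part over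
  \<open>\<rho> \<ge> 3\<close> is bounded by the tail estimate; the cut at \<open>3\<close> only has to stay away from \<open>2\<close>. The
  bound serves as the dominating function for \<open>R \<rightarrow> \<infinity>\<close>.\<close>

lemma G1_trunc_linear_growth:
  assumes r: "r > 0"
  obtains C where "C > 0" "\<And>R t. R \<ge> 0 \<Longrightarrow> t \<ge> 0 \<Longrightarrow> \<bar>G1_trunc t r R\<bar> \<le> C * (1 + t)"
proof -
  define C1 where "C1 = 3\<^sup>2 / (2 * pi\<^sup>2 * r)"
  define C2 where "C2 = 8 / (pi\<^sup>2 * r\<^sup>2 * sqrt (3\<^sup>2 - 4))"
  have C: "C1 > 0" "C2 > 0" using r by (simp_all add: C1_def C2_def)
  have small: "\<bar>G1_trunc t r R\<bar> \<le> C1 * t" if "R \<ge> 0" "R \<le> 3" "t \<ge> 0" for R t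
  proof -
    have "S1_hat 0 \<rho> = 0" if "\<rho> \<ge> 0" for \<rho> using S1_hat_abs_le[OF that, of 0] by simp
    then have "G1_trunc 0 r R = 0"
      unfolding G1_trunc_HK[OF order_refl]
      by (subst Henstock_Kurzweil_Integration.integral_cong[where g = "\<lambda>_. 0"]) auto
    then have "\<bar>G1_trunc t r R\<bar> \<le> R\<^sup>2 / (2 * pi\<^sup>2 * r) * t"
      using G1_trunc_Lipschitz[OF r that(1,3), of 0] that by simp
    also have "\<dots> \<le> C1 * t" unfolding C1_def
      using that r by (intro mult_right_mono divide_right_mono power_mono) auto
    finally show ?thesis .
  qed
  have "\<bar>G1_trunc t r R\<bar> \<le> (C1 + C2) * (1 + t)" if "R \<ge> 0" "t \<ge> 0" for R t
  proof (cases "R \<le> 3")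
    case True
    then have "\<bar>G1_trunc t r R\<bar> \<le> C1 * t" using small that by auto
    also have "\<dots> \<le> (C1 + C2) * (1 + t)" using C that by (intro mult_mono) auto
    finally show ?thesis .
  next
    case False
    then have "\<bar>G1_trunc t r R - G1_trunc t r 3\<bar> \<le> C2"
      unfolding C2_def by (intro G1_trunc_Cauchy r that) auto
    moreover have "\<bar>G1_trunc t r 3\<bar> \<le> C1 * t" using small that by auto
    ultimately have "\<bar>G1_trunc t r R\<bar> \<le> C2 + C1 * t" by linarith
    also have "\<dots> \<le> (C1 + C2) * (1 + t)" using C that by (simp add: algebra_simps)
    finally show ?thesis .
  qed
  with C show ?thesis by (intro that[of "C1 + C2"]) auto
qed

section \<open>The sine transform of a resolvent\<close>

lemma LBINT_exp_cos:
  fixes a \<rho> :: real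
  assumes "a > 0"
  shows "(LBINT x:{0..}. a * exp (- a * x) * cos (\<rho> * x)) = a\<^sup>2 / (\<rho>\<^sup>2 + a\<^sup>2)"
proof -
  define D where "D = \<rho>\<^sup>2 + a\<^sup>2"
  have D: "D > 0" using assms by (simp add: D_def add_nonneg_pos)
  define F where "F x = a * exp (- a * x) * (\<rho> * sin (\<rho> * x) - a * cos (\<rho> * x)) / D" for x
  note int = set_integrable_exp[OF assms]
  have "(LBINT x:{0..}. a * exp (- a * x) * cos (\<rho> * x)) = 0 - F 0"
  proof (rule LBINT_FTC_atLeast)
    show "set_integrable lborel {0..} (\<lambda>x. a * exp (- a * x) * cos (\<rho> * x))"
      unfolding set_integrable_def
    proof (rule Bochner_Integration.integrable_bound)
      show "integrable lborel (\<lambda>x. a * (indicator {0..} x *\<^sub>R exp (- a * x)))"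
        using int unfolding set_integrable_def by (rule integrable_mult_right)
    qed (use assms in \<open>auto simp: indicator_def abs_mult\<close>)
    show "(F has_real_derivative a * exp (- a * x) * cos (\<rho> * x)) (at x)" for x
    proof -
      have "((\<lambda>x. a * exp (- a * x) * (\<rho> * sin (\<rho> * x) - a * cos (\<rho> * x)))
          has_real_derivative D * (a * exp (- a * x) * cos (\<rho> * x))) (at x)"
        by (rule derivative_eq_intros refl)+ (simp add: D_def algebra_simps power2_eq_square)
      from DERIV_cmult[OF this, of "1 / D"] show ?thesis
        using D by (simp add: F_def[abs_def])
    qed
    show "continuous_on {0..} (\<lambda>x. a * exp (- a * x) * cos (\<rho> * x))"
      by (intro continuous_intros)
    show "(F \<longlongrightarrow> 0) at_top"
    proof (rule Lim_null_comparison)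
      show "\<forall>\<^sub>F x in at_top. norm (F x) \<le> a * exp (- a * x) * (\<bar>\<rho>\<bar> + a) / D"
      proof (rule always_eventually, rule allI)
        fix x
        have "\<bar>\<rho> * sin (\<rho> * x) - a * cos (\<rho> * x)\<bar> \<le> \<bar>\<rho> * sin (\<rho> * x)\<bar> + \<bar>a * cos (\<rho> * x)\<bar>"
          by (rule abs_triangle_ineq4)
        also have "\<dots> \<le> \<bar>\<rho>\<bar> * 1 + a * 1"
          unfolding abs_mult using assms by (intro add_mono mult_mono) auto
        finally show "norm (F x) \<le> a * exp (- a * x) * (\<bar>\<rho>\<bar> + a) / D"
          using D assms by (simp add: F_def abs_mult divide_right_mono)
      qed
      have "((\<lambda>x. a * exp (- a * x) * c) \<longlongrightarrow> 0) at_top" for c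
        using assms by real_asymp
      from tendsto_divide[OF this tendsto_const[of D]]
      show "((\<lambda>x. a * exp (- a * x) * (\<bar>\<rho>\<bar> + a) / D) \<longlongrightarrow> 0) at_top"
        using D by simp
    qed
  qed
  then show ?thesis by (simp add: F_def D_def power2_eq_square)
qed

lemma abs_sin_divide_le:
  fixes r x :: real
  assumes "r > 0"
  shows "\<bar>sin (r * x) / x\<bar> \<le> r"
proof (cases "x = 0")
  case False
  have "\<bar>sin (r * x)\<bar> \<le> r * \<bar>x\<bar>" using abs_sin_x_le_abs_x[of "r * x"] assms by (simp add: abs_mult)
  with False show ?thesis by (simp add: field_simps)
qed (use assms in simp)

lemma set_integrable_sin_divide:
  fixes r :: real
  assumes "r > 0" and [measurable]: "h \<in> borel_measurable borel" and h: "\<And>x. \<bar>h x\<bar> \<le> 1"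
  shows "set_integrable lborel {0..R} (\<lambda>x. sin (r * x) / x * h x)"
  unfolding set_integrable_def
proof (rule Bochner_Integration.integrable_bound)
  show "integrable lborel (\<lambda>x. indicator {0..R} x *\<^sub>R r)"
    by (rule borel_integrable_atLeastAtMost'[unfolded set_integrable_def]) auto
  have "\<bar>sin (r * x) / x * h x\<bar> \<le> r" for x
  proof -
    have "\<bar>sin (r * x) / x\<bar> * \<bar>h x\<bar> \<le> r * 1"
      using abs_sin_divide_le[OF assms(1), of x] h[of x] assms(1) by (intro mult_mono) auto
    then show ?thesis by (simp add: abs_mult)
  qed
  then show "AE x in lborel. norm (indicator {0..R} x *\<^sub>R (sin (r * x) / x * h x)) \<le> norm (indicator {0..R} x *\<^sub>R r)"
    unfolding norm_scaleR using assms(1) by (intro AE_I2 mult_left_mono) (simp_all only: real_norm_def abs_of_pos abs_ge_zero)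
qed simp

lemma set_LBINT_sin_divide:
  fixes c R :: real
  assumes "R \<ge> 0"
  shows "(LBINT \<rho>:{0..R}. sin (c * \<rho>) / \<rho>) = sgn c * Si (R * \<bar>c\<bar>)"
    and "set_integrable lborel {0..R} (\<lambda>\<rho>. sin (c * \<rho>) / \<rho>)"
proof -
  show "(LBINT \<rho>:{0..R}. sin (c * \<rho>) / \<rho>) = sgn c * Si (R * \<bar>c\<bar>)"
    using LBINT_I0c_sin_scale_divide[OF assms, of c] interval_integral_Icc[of 0 R "\<lambda>t. sin (c * t) / t"] assms
    by (simp add: mult.commute zero_ereal_def)
  consider "c > 0" | "c = 0" | "- c > 0" by linarith
  then show "set_integrable lborel {0..R} (\<lambda>\<rho>. sin (c * \<rho>) / \<rho>)"
  proof cases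
    case 1 then show ?thesis using set_integrable_sin_divide[of c "\<lambda>_. 1" R] by simp
  next
    case 2 then show ?thesis by (simp add: set_integrable_def)
  next
    case 3 then show ?thesis using set_integrable_sin_divide[of "- c" "\<lambda>_. -1" R] by simp
  qed
qed

lemma LBINT_sin_cos_divide:
  fixes r x R :: real
  assumes "R \<ge> 0"
  shows "(LBINT \<rho>:{0..R}. sin (r * \<rho>) / \<rho> * cos (\<rho> * x))
    = (sgn (r + x) * Si (R * \<bar>r + x\<bar>) + sgn (r - x) * Si (R * \<bar>r - x\<bar>)) / 2"
proof -
  have "sin (r * \<rho>) / \<rho> * cos (\<rho> * x) = (sin ((r + x) * \<rho>) / \<rho> + sin ((r - x) * \<rho>) / \<rho>) / 2" for \<rho>
    by (simp add: sin_add sin_diff distrib_right left_diff_distrib mult.commute[of x] flip: add_divide_distrib)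
  then have "(LBINT \<rho>:{0..R}. sin (r * \<rho>) / \<rho> * cos (\<rho> * x))
    = (LBINT \<rho>:{0..R}. (sin ((r + x) * \<rho>) / \<rho> + sin ((r - x) * \<rho>) / \<rho>) / 2)"
    by (simp only:)
  also have "\<dots> = (LBINT \<rho>:{0..R}. sin ((r + x) * \<rho>) / \<rho> + sin ((r - x) * \<rho>) / \<rho>) / 2"
    by (rule set_integral_divide_zero)
  finally show ?thesis
    using set_LBINT_sin_divide[OF assms]
    by (simp add: set_integral_add(2))
qed

lemma Si_scaled_limit:
  assumes "c \<noteq> 0"
  shows "((\<lambda>R. sgn c * Si (R * \<bar>c\<bar>)) \<longlongrightarrow> sgn c * (pi / 2)) at_top"
proof (intro tendsto_intros filterlim_compose[OF Si_at_top])
  show "filterlim (\<lambda>R. R * \<bar>c\<bar>) at_top at_top"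
    using assms filterlim_at_top_mult_tendsto_pos[OF tendsto_const[of "\<bar>c\<bar>"] _ filterlim_ident] by simp
qed

lemma truncated_exponential_weight:
  fixes a r :: real
  assumes "a > 0" "r > 0"
  shows "(LBINT x:{0..}. a * exp (- a * x) * (pi / 2 * indicator {..<r} x)) = pi / 2 * (1 - exp (- a * r))"
proof -
  have "(LBINT x:{0..}. a * exp (- a * x) * (pi / 2 * indicator {..<r} x))
     = (LBINT x. indicator {0..r} x *\<^sub>R (pi / 2 * (a * exp (- a * x))))"
    unfolding set_lebesgue_integral_def
  proof (rule integral_cong_AE)
    show "AE x in lborel. indicator {0..} x *\<^sub>R (a * exp (- a * x) * (pi / 2 * indicator {..<r} x))
        = indicator {0..r} x *\<^sub>R (pi / 2 * (a * exp (- a * x)))"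
      using AE_lborel_singleton[of r] by eventually_elim (auto simp: indicator_def)
  qed auto
  also have "\<dots> = (- (pi / 2 * exp (- a * r))) - (- (pi / 2 * exp (- a * 0)))"
  proof (rule integral_FTC_atLeastAtMost)
    show "((\<lambda>x. - (pi / 2 * exp (- a * x))) has_vector_derivative pi / 2 * (a * exp (- a * x))) (at x within {0..r})" for x
      unfolding has_real_derivative_iff_has_vector_derivative[symmetric]
      by (rule derivative_eq_intros refl)+ simp
  qed (use assms in \<open>auto intro!: continuous_intros\<close>)
  finally show ?thesis by (simp add: algebra_simps)
qed

text \<open>Writing \<open>a\<^sup>2 / (\<rho>\<^sup>2 + a\<^sup>2)\<close> as the cosine transform of \<open>a * exp (- a * x)\<close> and changing the order
  of integration leaves the Dirichlet integrals of \<open>sin (r * \<rho>) * cos (\<rho> * x) / \<rho>\<close>. These are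
  bounded and converge to \<open>pi / 2\<close> for \<open>x < r\<close> and to \<open>0\<close> for \<open>x > r\<close>, so that only the mass of
  \<open>a * exp (- a * x)\<close> on \<open>{0..<r}\<close> survives.\<close>

lemma sine_transform_remainder:
  fixes a r :: real
  assumes a: "a > 0" and r: "r > 0"
  shows "((\<lambda>R. LBINT \<rho>:{0..R}. sin (r * \<rho>) / \<rho> * (a\<^sup>2 / (\<rho>\<^sup>2 + a\<^sup>2))) \<longlongrightarrow> pi / 2 * (1 - exp (- a * r))) at_top"
proof -
  define k where "k R x = (LBINT \<rho>:{0..R}. sin (r * \<rho>) / \<rho> * cos (\<rho> * x))" for R x
  note ek = set_integrable_exp[OF a]
  have swap: "(LBINT \<rho>:{0..R}. sin (r * \<rho>) / \<rho> * (a\<^sup>2 / (\<rho>\<^sup>2 + a\<^sup>2))) = (LBINT x:{0..}. a * exp (- a * x) * k R x)" for R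
  proof -
    have "(LBINT \<rho>:{0..R}. sin (r * \<rho>) / \<rho> * (a\<^sup>2 / (\<rho>\<^sup>2 + a\<^sup>2)))
       = (LBINT \<rho>:{0..R}. LBINT x:{0..}. sin (r * \<rho>) / \<rho> * (a * exp (- a * x) * cos (\<rho> * x)))"
      by (simp only: LBINT_exp_cos[OF a, symmetric] set_integral_mult_right)
    also have "\<dots> = (LBINT x:{0..}. LBINT \<rho>:{0..R}. sin (r * \<rho>) / \<rho> * (a * exp (- a * x) * cos (\<rho> * x)))"
    proof (rule Fubini_strip[symmetric])
      show "set_integrable lborel {0..} (\<lambda>x. r * a * exp (- a * x))"
        using set_integrable_mult_right[OF ek] by simp
      fix \<rho> x :: real
      have "\<bar>sin (r * \<rho>) / \<rho>\<bar> * (a * exp (- a * x) * \<bar>cos (\<rho> * x)\<bar>) \<le> r * (a * exp (- a * x) * 1)"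
        using a r abs_sin_divide_le[OF r] by (intro mult_mono) auto
      then show "\<bar>sin (r * \<rho>) / \<rho> * (a * exp (- a * x) * cos (\<rho> * x))\<bar> \<le> r * a * exp (- a * x)"
        using a by (simp add: abs_mult)
    qed measurable
    also have "\<dots> = (LBINT x:{0..}. a * exp (- a * x) * k R x)"
      unfolding k_def by (simp only: set_integral_mult_right[symmetric] mult_ac)
    finally show ?thesis .
  qed
  obtain B where B: "\<And>T. \<bar>Si T\<bar> \<le> B" using bounded_Si by blast
  have "((\<lambda>R. LBINT x:{0..}. a * exp (- a * x) * k R x) \<longlongrightarrow> (LBINT x:{0..}. a * exp (- a * x) * (pi / 2 * indicator {..<r} x))) at_top"
    unfolding set_lebesgue_integral_def
  proof (rule integral_dominated_convergence_at_top[where w = "\<lambda>x. indicator {0..} x *\<^sub>R (a * B * exp (- a * x))"])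
    show "integrable lborel (\<lambda>x. indicator {0..} x *\<^sub>R (a * B * exp (- a * x)))"
      using set_integrable_mult_right[OF ek] by (simp add: set_integrable_def)
    show "(\<lambda>x. indicator {0..} x *\<^sub>R (a * exp (- a * x) * k t x)) \<in> borel_measurable lborel" for t
      unfolding k_def set_lebesgue_integral_def by measurable
    show "(\<lambda>x. indicator {0..} x *\<^sub>R (a * exp (- a * x) * (pi / 2 * indicator {..<r} x))) \<in> borel_measurable lborel"
      by measurable
    show "\<forall>\<^sub>F R in at_top. AE x in lborel. norm (indicator {0..} x *\<^sub>R (a * exp (- a * x) * k R x))
        \<le> indicator {0..} x *\<^sub>R (a * B * exp (- a * x))"
      using eventually_ge_at_top[of 0]
    proof eventually_elim
      case (elim R)
      have sB: "\<bar>sgn c * Si T\<bar> \<le> B" for c T :: real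
        using B[of T] B[of 0] by (auto simp: sgn_real_def abs_mult)
      have avg: "\<bar>(u + v) / 2\<bar> \<le> B" if "\<bar>u\<bar> \<le> B" "\<bar>v\<bar> \<le> B" for u v :: real
        using that by (simp add: abs_le_iff)
      have kB: "\<bar>k R x\<bar> \<le> B" for x
        unfolding k_def LBINT_sin_cos_divide[OF elim] by (intro avg sB)
      have "a * exp (- a * x) * \<bar>k R x\<bar> \<le> a * exp (- a * x) * B" for x
        using kB[of x] a by (intro mult_left_mono) auto
      then show ?case
        using a by (intro AE_I2) (simp add: indicator_def abs_mult mult_ac)
    qed
    show "AE x in lborel. ((\<lambda>R. indicator {0..} x *\<^sub>R (a * exp (- a * x) * k R x)) \<longlongrightarrow>
        indicator {0..} x *\<^sub>R (a * exp (- a * x) * (pi / 2 * indicator {..<r} x))) at_top"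
    proof (rule AE_mp[OF AE_lborel_singleton[of r]], intro AE_I2 impI)
      fix x assume xr: "x \<noteq> r"
      show "((\<lambda>R. indicator {0..} x *\<^sub>R (a * exp (- a * x) * k R x)) \<longlongrightarrow>
        indicator {0..} x *\<^sub>R (a * exp (- a * x) * (pi / 2 * indicator {..<r} x))) at_top"
      proof (cases "x \<ge> 0")
        case True
        have "((\<lambda>R. (sgn (r + x) * Si (R * \<bar>r + x\<bar>) + sgn (r - x) * Si (R * \<bar>r - x\<bar>)) / 2) \<longlongrightarrow>
           (sgn (r + x) * (pi / 2) + sgn (r - x) * (pi / 2)) / 2) at_top"
          by (intro tendsto_divide tendsto_add tendsto_const Si_scaled_limit) (use True r xr in auto)
        also have "(sgn (r + x) * (pi / 2) + sgn (r - x) * (pi / 2)) / 2 = pi / 2 * indicator {..<r} x"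
          using True r xr by (auto simp: sgn_real_def indicator_def)
        finally have "((\<lambda>R. k R x) \<longlongrightarrow> pi / 2 * indicator {..<r} x) at_top"
          by (rule Lim_transform_eventually)
            (use eventually_ge_at_top[of 0] in \<open>eventually_elim, simp only: k_def LBINT_sin_cos_divide\<close>)
        then show ?thesis by (intro tendsto_intros)
      qed simp
    qed
  qed
  then show ?thesis by (simp only: swap truncated_exponential_weight[OF a r])
qed

text \<open>The transform converges only conditionally. Subtracting the Dirichlet integral isolates the
  slow decay: \<open>\<rho> / (\<rho>\<^sup>2 + a\<^sup>2) = 1 / \<rho> - (1 / \<rho>) * (a\<^sup>2 / (\<rho>\<^sup>2 + a\<^sup>2))\<close>.\<close>

lemma sine_transform_resolvent:
  fixes a r :: real
  assumes a: "a > 0" and r: "r > 0"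
  shows "((\<lambda>R. LBINT \<rho>:{0..R}. \<rho> * sin (r * \<rho>) / (\<rho>\<^sup>2 + a\<^sup>2)) \<longlongrightarrow> pi / 2 * exp (- a * r)) at_top"
proof -
  have "((\<lambda>R. sgn r * Si (R * \<bar>r\<bar>) - (LBINT \<rho>:{0..R}. sin (r * \<rho>) / \<rho> * (a\<^sup>2 / (\<rho>\<^sup>2 + a\<^sup>2))))
     \<longlongrightarrow> sgn r * (pi / 2) - pi / 2 * (1 - exp (- a * r))) at_top"
    by (intro tendsto_diff Si_scaled_limit sine_transform_remainder assms) (use r in auto)
  also have "sgn r * (pi / 2) - pi / 2 * (1 - exp (- a * r)) = pi / 2 * exp (- a * r)"
    using r by (simp add: algebra_simps)
  finally show ?thesis
  proof (rule Lim_transform_eventually)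
    show "\<forall>\<^sub>F R in at_top. sgn r * Si (R * \<bar>r\<bar>) - (LBINT \<rho>:{0..R}. sin (r * \<rho>) / \<rho> * (a\<^sup>2 / (\<rho>\<^sup>2 + a\<^sup>2)))
       = (LBINT \<rho>:{0..R}. \<rho> * sin (r * \<rho>) / (\<rho>\<^sup>2 + a\<^sup>2))"
      using eventually_ge_at_top[of 0]
    proof eventually_elim
      case (elim R)
      have pos: "x\<^sup>2 + a\<^sup>2 > 0" for x using a by (simp add: add_nonneg_pos)
      have "set_integrable lborel {0..R} (\<lambda>\<rho>. sin (r * \<rho>) / \<rho> * (a\<^sup>2 / (\<rho>\<^sup>2 + a\<^sup>2)))"
        using pos by (intro set_integrable_sin_divide r) (auto simp: abs_if divide_simps)
      then have "sgn r * Si (R * \<bar>r\<bar>) - (LBINT \<rho>:{0..R}. sin (r * \<rho>) / \<rho> * (a\<^sup>2 / (\<rho>\<^sup>2 + a\<^sup>2)))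
        = (LBINT \<rho>:{0..R}. sin (r * \<rho>) / \<rho> - sin (r * \<rho>) / \<rho> * (a\<^sup>2 / (\<rho>\<^sup>2 + a\<^sup>2)))"
        using set_LBINT_sin_divide[OF elim, of r] by (subst set_integral_diff(2)) auto
      also have "\<dots> = (LBINT \<rho>:{0..R}. \<rho> * sin (r * \<rho>) / (\<rho>\<^sup>2 + a\<^sup>2))"
      proof (rule set_lebesgue_integral_cong)
        show "\<forall>x. x \<in> {0..R} \<longrightarrow> sin (r * x) / x - sin (r * x) / x * (a\<^sup>2 / (x\<^sup>2 + a\<^sup>2)) = x * sin (r * x) / (x\<^sup>2 + a\<^sup>2)"
        proof (intro allI impI)
          fix x
          show "sin (r * x) / x - sin (r * x) / x * (a\<^sup>2 / (x\<^sup>2 + a\<^sup>2)) = x * sin (r * x) / (x\<^sup>2 + a\<^sup>2)"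
          proof -
            have "x\<^sup>2 / (x\<^sup>2 + a\<^sup>2) = (x\<^sup>2 + a\<^sup>2 - a\<^sup>2) / (x\<^sup>2 + a\<^sup>2)" by simp
            also have "\<dots> = 1 - a\<^sup>2 / (x\<^sup>2 + a\<^sup>2)"
              using less_imp_neq[OF pos[of x]] by (simp only: diff_divide_distrib divide_self not_sym)
            finally have "sin (r * x) / x - sin (r * x) / x * (a\<^sup>2 / (x\<^sup>2 + a\<^sup>2)) = sin (r * x) / x * (x\<^sup>2 / (x\<^sup>2 + a\<^sup>2))"
              by (metis mult.right_neutral right_diff_distrib)
            also have "\<dots> = x * sin (r * x) / (x\<^sup>2 + a\<^sup>2)" by (cases "x = 0") (simp_all add: power2_eq_square)
            finally show ?thesis .
          qed
        qed
      qed simp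
      finally show ?case .
    qed
  qed
qed

section \<open>The Laplace transform of the fundamental solution\<close>

lemma G1_trunc_measurable [measurable]: "(\<lambda>t. G1_trunc t r R) \<in> borel_measurable borel"
  unfolding G1_trunc_def set_lebesgue_integral_def by measurable

lemma G1_trunc_laplace:
  assumes r: "r > 0" and s: "s > 0" and R: "R \<ge> 0"
  shows "(LBINT t:{0..}. exp (- s * t) * G1_trunc t r R)
    = 1 / (2 * pi\<^sup>2 * r) * (LBINT \<rho>:{0..R}. \<rho> * sin (r * \<rho>) / (s\<^sup>2 + s * \<rho>\<^sup>2 + \<rho>\<^sup>2))"
proof -
  let ?f = "\<lambda>\<rho> t. exp (- s * t) * (S1_hat t \<rho> * \<rho> * sin (r * \<rho>))"
  have "exp (- s * t) * G1_trunc t r R = 1 / (2 * pi\<^sup>2 * r) * (LBINT \<rho>:{0..R}. ?f \<rho> t)" for t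
    unfolding G1_trunc_def set_integral_mult_right by (rule mult.left_commute)
  then have "(LBINT t:{0..}. exp (- s * t) * G1_trunc t r R)
      = (LBINT t:{0..}. 1 / (2 * pi\<^sup>2 * r) * (LBINT \<rho>:{0..R}. ?f \<rho> t))"
    by (simp only:)
  also have "\<dots> = 1 / (2 * pi\<^sup>2 * r) * (LBINT t:{0..}. LBINT \<rho>:{0..R}. ?f \<rho> t)"
    by (simp only: set_integral_mult_right)
  also have "(LBINT t:{0..}. LBINT \<rho>:{0..R}. ?f \<rho> t) = (LBINT \<rho>:{0..R}. LBINT t:{0..}. ?f \<rho> t)"
  proof (rule Fubini_strip)
    show "set_integrable lborel {0..} (\<lambda>t. R * ((0 + t) * exp (- s * t)))"
      by (intro set_integrable_mult_right set_integrable_exp_mult s)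
    fix \<rho> t :: real assume \<rho>: "0 \<le> \<rho>" "\<rho> \<le> R" and t: "0 \<le> t"
    have "\<bar>S1_hat t \<rho>\<bar> * \<bar>\<rho>\<bar> * \<bar>sin (r * \<rho>)\<bar> \<le> t * R * 1"
      using S1_hat_abs_le[of \<rho> t] \<rho> t by (intro mult_mono) auto
    then have "exp (- s * t) * (\<bar>S1_hat t \<rho>\<bar> * \<bar>\<rho>\<bar> * \<bar>sin (r * \<rho>)\<bar>) \<le> exp (- s * t) * (t * R * 1)"
      by (intro mult_left_mono) auto
    then show "\<bar>?f \<rho> t\<bar> \<le> R * ((0 + t) * exp (- s * t))"
      by (simp add: abs_mult mult_ac)
  qed measurable
  also have "\<dots> = (LBINT \<rho>:{0..R}. \<rho> * sin (r * \<rho>) / (s\<^sup>2 + s * \<rho>\<^sup>2 + \<rho>\<^sup>2))"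
  proof (rule set_lebesgue_integral_cong)
    show "\<forall>\<rho>. \<rho> \<in> {0..R} \<longrightarrow> (LBINT t:{0..}. ?f \<rho> t) = \<rho> * sin (r * \<rho>) / (s\<^sup>2 + s * \<rho>\<^sup>2 + \<rho>\<^sup>2)"
    proof (intro allI impI)
      fix \<rho> :: real assume "\<rho> \<in> {0..R}"
      then have "\<rho> \<ge> 0" by simp
      have "(LBINT t:{0..}. ?f \<rho> t) = (LBINT t:{0..}. \<rho> * sin (r * \<rho>) * (exp (- s * t) * S1_hat t \<rho>))"
        by (simp only: mult_ac)
      also have "\<dots> = \<rho> * sin (r * \<rho>) * (1 / (s\<^sup>2 + s * \<rho>\<^sup>2 + \<rho>\<^sup>2))"
        by (simp only: set_integral_mult_right S1_hat_laplace(2)[OF \<open>\<rho> \<ge> 0\<close> s])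
      finally show "(LBINT t:{0..}. ?f \<rho> t) = \<rho> * sin (r * \<rho>) / (s\<^sup>2 + s * \<rho>\<^sup>2 + \<rho>\<^sup>2)"
        by simp
    qed
  qed simp
  finally show ?thesis .
qed

text \<open>For each \<open>R\<close> the transform of the truncated integral is elementary. The limit \<open>R \<rightarrow> \<infinity>\<close> passes
  through the Laplace integral by dominated convergence, and on the other side it produces the
  sine transform of the resolvent.\<close>

lemma G1_laplace:
  assumes r: "r > 0" and s: "s > 0"
  shows "set_integrable lborel {0..} (\<lambda>t. exp (- s * t) * G1 t r)"
    and "(LBINT t:{0..}. exp (- s * t) * G1 t r) = 1 / (4 * pi * r * (1 + s)) * exp (- r * s / sqrt (1 + s))"
proof -
  \<comment> \<open>With this \<open>a\<close> the transformed symbol is a resolvent: \<open>s\<^sup>2 + s * \<rho>\<^sup>2 + \<rho>\<^sup>2 = (1 + s) * (\<rho>\<^sup>2 + a\<^sup>2)\<close>.\<close>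
  define a where "a = s / sqrt (1 + s)"
  have a: "a > 0" using s by (simp add: a_def)
  have a2: "(1 + s) * a\<^sup>2 = s\<^sup>2" using s by (simp add: a_def power_divide)
  have symbol: "s\<^sup>2 + s * \<rho>\<^sup>2 + \<rho>\<^sup>2 = (1 + s) * (\<rho>\<^sup>2 + a\<^sup>2)" for \<rho>
    using a2 by (simp add: algebra_simps)
  obtain C where C: "C > 0" "\<And>R t. R \<ge> 0 \<Longrightarrow> t \<ge> 0 \<Longrightarrow> \<bar>G1_trunc t r R\<bar> \<le> C * (1 + t)"
    using G1_trunc_linear_growth[OF r] by metis
  let ?w = "\<lambda>t. indicator {0..} t *\<^sub>R (C * ((1 + t) * exp (- s * t)))"
  have w: "integrable lborel ?w"
    using set_integrable_mult_right[OF set_integrable_exp_mult[OF s, of 1]] by (simp add: set_integrable_def)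
  have "(\<lambda>t. indicator {0..} t *\<^sub>R (exp (- s * t) * G1 t r)) \<in> borel_measurable borel"
    by (rule borel_measurable_continuous_on_indicator) (auto intro!: continuous_intros G1_continuous_on r)
  then have G1m: "(\<lambda>t. indicator {0..} t *\<^sub>R (exp (- s * t) * G1 t r)) \<in> borel_measurable lborel"
    by simp
  have tm: "(\<lambda>t. indicator {0..} t *\<^sub>R (exp (- s * t) * G1_trunc t r R)) \<in> borel_measurable lborel" for R
    by measurable
  have lim: "AE t in lborel. ((\<lambda>R. indicator {0..} t *\<^sub>R (exp (- s * t) * G1_trunc t r R)) \<longlongrightarrow>
      indicator {0..} t *\<^sub>R (exp (- s * t) * G1 t r)) at_top"
  proof (rule AE_I2)
    fix t :: real
    show "((\<lambda>R. indicator {0..} t *\<^sub>R (exp (- s * t) * G1_trunc t r R)) \<longlongrightarrow>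
      indicator {0..} t *\<^sub>R (exp (- s * t) * G1 t r)) at_top"
      by (cases "t \<ge> 0") (auto intro!: tendsto_intros G1_trunc_tendsto_uniformly r)
  qed
  have bound: "\<forall>\<^sub>F R in at_top. AE t in lborel.
      norm (indicator {0..} t *\<^sub>R (exp (- s * t) * G1_trunc t r R)) \<le> ?w t"
    using eventually_ge_at_top[of 0]
  proof eventually_elim
    case (elim R)
    have "exp (- s * t) * \<bar>G1_trunc t r R\<bar> \<le> exp (- s * t) * (C * (1 + t))" if "t \<ge> 0" for t
      using C(2)[OF elim that] by (intro mult_left_mono) auto
    then show ?case by (intro AE_I2) (simp add: indicator_def abs_mult mult_ac)
  qed
  show "set_integrable lborel {0..} (\<lambda>t. exp (- s * t) * G1 t r)"
    unfolding set_integrable_def by (rule integrable_dominated_convergence_at_top[OF G1m tm w lim bound])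
  have "((\<lambda>R. LBINT t:{0..}. exp (- s * t) * G1_trunc t r R) \<longlongrightarrow> (LBINT t:{0..}. exp (- s * t) * G1 t r)) at_top"
    unfolding set_lebesgue_integral_def by (rule integral_dominated_convergence_at_top[OF G1m tm w lim bound])
  moreover have "((\<lambda>R. LBINT t:{0..}. exp (- s * t) * G1_trunc t r R) \<longlongrightarrow>
      1 / (2 * pi\<^sup>2 * r) * (1 / (1 + s) * (pi / 2 * exp (- a * r)))) at_top"
  proof (rule Lim_transform_eventually)
    show "((\<lambda>R. 1 / (2 * pi\<^sup>2 * r) * (1 / (1 + s) * (LBINT \<rho>:{0..R}. \<rho> * sin (r * \<rho>) / (\<rho>\<^sup>2 + a\<^sup>2)))) \<longlongrightarrow>
      1 / (2 * pi\<^sup>2 * r) * (1 / (1 + s) * (pi / 2 * exp (- a * r)))) at_top"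
      by (intro tendsto_mult tendsto_const sine_transform_resolvent a r)
    have L: "(LBINT \<rho>:{0..R}. \<rho> * sin (r * \<rho>) / (s\<^sup>2 + s * \<rho>\<^sup>2 + \<rho>\<^sup>2))
        = 1 / (1 + s) * (LBINT \<rho>:{0..R}. \<rho> * sin (r * \<rho>) / (\<rho>\<^sup>2 + a\<^sup>2))" for R
      unfolding symbol by (subst set_integral_mult_right[symmetric]) simp
    show "\<forall>\<^sub>F R in at_top. 1 / (2 * pi\<^sup>2 * r) * (1 / (1 + s) * (LBINT \<rho>:{0..R}. \<rho> * sin (r * \<rho>) / (\<rho>\<^sup>2 + a\<^sup>2)))
        = (LBINT t:{0..}. exp (- s * t) * G1_trunc t r R)"
      using eventually_ge_at_top[of 0] by eventually_elim (simp only: G1_trunc_laplace[OF r s] L)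
  qed
  ultimately have "(LBINT t:{0..}. exp (- s * t) * G1 t r) = 1 / (2 * pi\<^sup>2 * r) * (1 / (1 + s) * (pi / 2 * exp (- a * r)))"
    by (rule tendsto_unique[OF trivial_limit_at_top_linorder])
  also have "\<dots> = 1 / (4 * pi * r * (1 + s)) * exp (- r * s / sqrt (1 + s))"
    by (simp add: a_def power2_eq_square mult.commute)
  finally show "(LBINT t:{0..}. exp (- s * t) * G1 t r) = 1 / (4 * pi * r * (1 + s)) * exp (- r * s / sqrt (1 + s))" .
qed

section \<open>Uniqueness of the Laplace transform of a measure\<close>

text \<open>Polynomials are uniformly dense in the continuous functions on \<open>{0..1}\<close>, so equal moments give
  equal integrals of continuous functions; ramps converging to indicators of rays then identify
  the measures.\<close>

lemma finite_measure_eq_by_moments: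
  fixes M N :: "real measure"
  assumes sets [measurable_cong]: "sets M = sets borel" "sets N = sets borel"
    and fin: "finite_measure M" "finite_measure N"
    and supp: "AE x in M. x \<in> {0..1}" "AE x in N. x \<in> {0..1}"
    and moments: "\<And>n. (\<integral>x. x ^ n \<partial>M) = (\<integral>x. x ^ n \<partial>N)"
  shows "M = N"
proof -
  interpret M: finite_measure M by (rule fin)
  interpret N: finite_measure N by (rule fin)
  have int: "integrable K f"
    if "finite_measure K" "AE x in K. x \<in> {0..1}" "continuous_on UNIV f" "sets K = sets borel"
    for K and f :: "real \<Rightarrow> real"
  proof -
    interpret K: finite_measure K by (rule that)
    have "compact (f ` {0..1})" using that(3) by (intro compact_continuous_image continuous_on_subset[OF that(3)]) auto
    then obtain B where B: "\<And>x. x \<in> {0..1} \<Longrightarrow> norm (f x) \<le> B"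
      using compact_imp_bounded bounded_iff by (metis imageI)
    show ?thesis
    proof (rule K.integrable_const_bound)
      show "AE x in K. norm (f x) \<le> B" using that(2) by eventually_elim (use B in auto)
      show "f \<in> borel_measurable K"
        using borel_measurable_continuous_onI[OF that(3)] that(4) by (simp cong: measurable_cong_sets)
    qed
  qed
  note intM = int[OF fin(1) supp(1) _ sets(1)] and intN = int[OF fin(2) supp(2) _ sets(2)]
  have cont: "(\<integral>x. f x \<partial>M) = (\<integral>x. f x \<partial>N)" if f: "continuous_on UNIV f" for f :: "real \<Rightarrow> real"
  proof -
    let ?c = "measure M (space M) + measure N (space N) + 1"
    have "\<bar>(\<integral>x. f x \<partial>M) - (\<integral>x. f x \<partial>N)\<bar> \<le> 0 + e" if "e > 0" for e
    proof -
      define d where "d = e / ?c"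
      have c: "?c > 0" by (simp add: add_nonneg_pos)
      then have d: "d > 0" using that by (simp add: d_def)
      obtain p where p: "real_polynomial_function p" "\<And>x. x \<in> {0..1} \<Longrightarrow> \<bar>f x - p x\<bar> < d"
        using Stone_Weierstrass_real_polynomial_function[of "{0..1}" f d] d f
        by (metis compact_Icc continuous_on_subset subset_UNIV)
      obtain a n where pa: "p = (\<lambda>x. \<Sum>i\<le>n. a i * x ^ i)"
        using p(1) real_polynomial_function_iff_sum by blast
      have pc: "continuous_on UNIV p" unfolding pa by (intro continuous_intros)
      have mono: "continuous_on UNIV (\<lambda>x::real. a i * x ^ i)" for i by (intro continuous_intros)
      have "(\<integral>x. p x \<partial>M) = (\<Sum>i\<le>n. a i * (\<integral>x. x ^ i \<partial>M))"
        unfolding pa by (subst Bochner_Integration.integral_sum) (use intM[OF mono] in auto)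
      also have "\<dots> = (\<Sum>i\<le>n. a i * (\<integral>x. x ^ i \<partial>N))" by (simp only: moments)
      also have "\<dots> = (\<integral>x. p x \<partial>N)"
        unfolding pa by (subst Bochner_Integration.integral_sum) (use intN[OF mono] in auto)
      finally have eq: "(\<integral>x. p x \<partial>M) = (\<integral>x. p x \<partial>N)" .
      have close: "\<bar>(\<integral>x. f x \<partial>K) - (\<integral>x. p x \<partial>K)\<bar> \<le> d * measure K (space K)"
        if K: "finite_measure K" "AE x in K. x \<in> {0..1}" "sets K = sets borel" for K
      proof -
        interpret K: finite_measure K by (rule K)
        have "\<bar>(\<integral>x. f x \<partial>K) - (\<integral>x. p x \<partial>K)\<bar> = norm (\<integral>x. f x - p x \<partial>K)"
          by (subst Bochner_Integration.integral_diff[OF int[OF K(1,2) f K(3)] int[OF K(1,2) pc K(3)]]) simp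
        also have "\<dots> \<le> (\<integral>x. norm (f x - p x) \<partial>K)" by (rule integral_norm_bound)
        also have "\<dots> \<le> (\<integral>x. d \<partial>K)"
        proof (rule integral_mono_AE)
          show "integrable K (\<lambda>x. norm (f x - p x))"
            by (intro integrable_norm Bochner_Integration.integrable_diff int[OF K(1,2) _ K(3)] f pc)
          show "AE x in K. norm (f x - p x) \<le> d"
            using K(2) by eventually_elim (use p(2) in \<open>auto simp: less_imp_le\<close>)
        qed simp
        also have "\<dots> = d * measure K (space K)" by simp
        finally show ?thesis .
      qed
      have "\<bar>(\<integral>x. f x \<partial>M) - (\<integral>x. f x \<partial>N)\<bar> \<le> d * measure M (space M) + d * measure N (space N)"
        using close[OF fin(1) supp(1) sets(1)] close[OF fin(2) supp(2) sets(2)] eq by linarith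
      also have "\<dots> \<le> d * ?c" using d by (simp add: distrib_left)
      also have "\<dots> = e" using c by (simp add: d_def)
      finally show ?thesis by simp
    qed
    then have "\<bar>(\<integral>x. f x \<partial>M) - (\<integral>x. f x \<partial>N)\<bar> \<le> 0" by (rule field_le_epsilon)
    then show ?thesis by simp
  qed
  \<comment> \<open>Continuous ramps increasing to the indicator of the open ray \<open>{a<..}\<close>.\<close>
  define \<psi> where "\<psi> a k y = max 0 (min 1 (real k * (y - a)))" for a :: real and k :: nat and y :: real
  have \<psi>c: "continuous_on UNIV (\<psi> a k)" for a k
    unfolding \<psi>_def by (intro continuous_intros)
  have lim: "(\<lambda>k. \<psi> a k y) \<longlonglongrightarrow> indicator {a<..} y" for a y
  proof (cases "y > a")
    case True
    obtain k0 :: nat where k0: "1 / (y - a) < real k0" using reals_Archimedean2 by blast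
    have "\<psi> a k y = 1" if "k \<ge> k0" for k
    proof -
      have "1 / (y - a) \<le> real k" using k0 that by (meson less_imp_le of_nat_le_iff order_trans)
      then have "1 \<le> real k * (y - a)" using True by (simp add: field_simps)
      then show ?thesis by (simp add: \<psi>_def)
    qed
    then have "\<forall>\<^sub>F k in sequentially. \<psi> a k y = 1" by (auto simp: eventually_sequentially)
    then show ?thesis using True by (auto intro: tendsto_eventually)
  next
    case False
    then have "real k * (y - a) \<le> 0" for k by (intro mult_nonneg_nonpos) auto
    then have "\<psi> a k y = 0" for k unfolding \<psi>_def by (metis max_absorb1 min.coboundedI2)
    with False show ?thesis by simp
  qed
  have tail: "(\<lambda>k. \<integral>y. \<psi> a k y \<partial>K) \<longlonglongrightarrow> measure K {a<..}"
    if K: "finite_measure K" "sets K = sets borel" for K a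
  proof -
    interpret K: finite_measure K by (rule K)
    have [measurable_cong]: "sets K = sets borel" by (rule K)
    have "(\<lambda>k. \<integral>y. \<psi> a k y \<partial>K) \<longlonglongrightarrow> (\<integral>y. indicator {a<..} y \<partial>K)"
    proof (rule integral_dominated_convergence[where w = "\<lambda>_. 1"])
      show "AE y in K. norm (\<psi> a k y) \<le> 1" for k by (simp add: \<psi>_def)
    qed (use lim in \<open>simp_all add: \<psi>_def\<close>)
    then show ?thesis using sets_eq_imp_space_eq[OF K(2)] by simp
  qed
  show ?thesis
  proof (rule measure_eqI_lessThan[OF sets])
    show "emeasure M {x<..} < \<infinity>" for x by (simp add: M.emeasure_eq_measure)
    show "emeasure M {x<..} = emeasure N {x<..}" for x
      using tail[OF fin(1) sets(1), of x] tail[OF fin(2) sets(2), of x] cont[OF \<psi>c]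
      by (simp add: M.emeasure_eq_measure N.emeasure_eq_measure LIMSEQ_unique)
  qed
qed

lemma borel_measurable_half_line:
  fixes f :: "real \<Rightarrow> 'b::topological_space"
  assumes "sets M = sets (restrict_space borel {0..})" "f \<in> borel_measurable borel"
  shows "f \<in> borel_measurable M"
  by (subst measurable_cong_sets[OF assms(1) refl]) (rule measurable_restrict_space1[OF assms(2)])

text \<open>The substitution \<open>x = exp (- t)\<close> combined with the tilt by \<open>exp (- t)\<close> loses no information.\<close>

lemma exp_tilted_image_recovers:
  fixes M :: "real measure"
  assumes sets: "sets M = sets (restrict_space borel {0..})" and A: "A \<in> sets M"
  shows "emeasure M A = (\<integral>\<^sup>+x. indicator A (- ln x) * ennreal (1 / x)
      \<partial>distr (density M (\<lambda>t. ennreal (exp (- t)))) borel (\<lambda>t. exp (- t)))"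
proof -
  have [measurable]: "A \<in> sets borel"
    using A sets by (auto simp: sets_restrict_space_iff)
  have [measurable]: "(\<lambda>t::real. exp (- t)) \<in> borel_measurable M"
    by (rule borel_measurable_half_line[OF sets]) measurable
  have "(\<integral>\<^sup>+x. indicator A (- ln x) * ennreal (1 / x)
      \<partial>distr (density M (\<lambda>t. ennreal (exp (- t)))) borel (\<lambda>t. exp (- t)))
    = (\<integral>\<^sup>+t. ennreal (exp (- t)) * (indicator A (- ln (exp (- t))) * ennreal (1 / exp (- t))) \<partial>M)"
  proof (subst nn_integral_distr)
    show "(\<integral>\<^sup>+ x. indicator A (- ln (exp (- x))) * ennreal (1 / exp (- x)) \<partial>density M (\<lambda>t. ennreal (exp (- t))))
      = (\<integral>\<^sup>+t. ennreal (exp (- t)) * (indicator A (- ln (exp (- t))) * ennreal (1 / exp (- t))) \<partial>M)"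
      by (rule nn_integral_density) (measurable, rule borel_measurable_half_line[OF sets], measurable)
  qed measurable
  also have "\<dots> = (\<integral>\<^sup>+t. indicator A t \<partial>M)"
  proof (rule nn_integral_cong)
    fix t
    have "ennreal (exp (- t)) * ennreal (1 / exp (- t)) = 1"
      by (subst ennreal_mult[symmetric]) auto
    then show "ennreal (exp (- t)) * (indicator A (- ln (exp (- t))) * ennreal (1 / exp (- t))) = indicator A t"
      by (simp add: mult.left_commute)
  qed
  also have "\<dots> = emeasure M A" using A by simp
  finally show ?thesis ..
qed

text \<open>The values of the transform at \<open>s = 1, 2, 3, \<dots>\<close> are the moments of a finite measure on \<open>{0..1}\<close>,
  the image of \<open>exp (- t) M(dt)\<close> under \<open>t \<mapsto> exp (- t)\<close>.\<close>

lemma laplace_transform_determines_measure: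
  fixes M N :: "real measure"
  assumes sets: "sets M = sets (restrict_space borel {0..})" "sets N = sets (restrict_space borel {0..})"
    and fin: "\<And>s. s > 0 \<Longrightarrow> (\<integral>\<^sup>+t. ennreal (exp (- s * t)) \<partial>M) < \<infinity>"
    and eq: "\<And>s. s > 0 \<Longrightarrow> (\<integral>\<^sup>+t. ennreal (exp (- s * t)) \<partial>M) = (\<integral>\<^sup>+t. ennreal (exp (- s * t)) \<partial>N)"
  shows "M = N"
proof -
  \<comment> \<open>The \<open>n\<close>-th moment of the tilted image \<open>T K\<close> is the transform of \<open>K\<close> at \<open>n + 1\<close>; the tilt by
    \<open>exp (- t)\<close> is what makes \<open>T K\<close> finite when \<open>K\<close> is not.\<close>
  define T where "T K = distr (density K (\<lambda>t. ennreal (exp (- t)))) borel (\<lambda>t::real. exp (- t))" for K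
  have moment: "(\<integral>\<^sup>+x. ennreal (x ^ n) \<partial>T K) = (\<integral>\<^sup>+t. ennreal (exp (- (real n + 1) * t)) \<partial>K)"
    if K: "sets K = sets (restrict_space borel {0..})" for n K
  proof -
    have [measurable]: "(\<lambda>t::real. exp (- t)) \<in> borel_measurable K" by (rule borel_measurable_half_line[OF K]) measurable
    have "(\<integral>\<^sup>+x. ennreal (x ^ n) \<partial>T K) = (\<integral>\<^sup>+t. ennreal (exp (- t) ^ n) \<partial>density K (\<lambda>t. ennreal (exp (- t))))"
      unfolding T_def by (rule nn_integral_distr) measurable
    also have "\<dots> = (\<integral>\<^sup>+t. ennreal (exp (- t)) * ennreal (exp (- t) ^ n) \<partial>K)"
      by (rule nn_integral_density) measurable
    also have "\<dots> = (\<integral>\<^sup>+t. ennreal (exp (- (real n + 1) * t)) \<partial>K)"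
      by (intro nn_integral_cong)
        (simp add: ennreal_mult[symmetric] exp_add[symmetric] exp_of_nat_mult[symmetric] algebra_simps)
    finally show ?thesis .
  qed
  have supp: "AE x in T K. x \<in> {0..1}" if K: "sets K = sets (restrict_space borel {0..})" for K
  proof -
    have [measurable]: "(\<lambda>t::real. exp (- t)) \<in> borel_measurable K" by (rule borel_measurable_half_line[OF K]) measurable
    have sp: "space K = {0..}" using sets_eq_imp_space_eq[OF K] by (simp add: space_restrict_space)
    show ?thesis
      unfolding T_def by (subst AE_distr_iff) (auto simp: AE_density sp)
  qed
  have finT: "finite_measure (T K)" if K: "sets K = sets (restrict_space borel {0..})"
    and f: "(\<integral>\<^sup>+t. ennreal (exp (- (real 0 + 1) * t)) \<partial>K) < \<infinity>" for K
  proof (rule finite_measureI)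
    have "emeasure (T K) (space (T K)) = (\<integral>\<^sup>+x. ennreal (x ^ 0) \<partial>T K)" by simp
    then show "emeasure (T K) (space (T K)) \<noteq> \<infinity>" using f moment[OF K, of 0] by simp
  qed
  have "(\<integral>x. x ^ n \<partial>T K) = enn2real (\<integral>\<^sup>+t. ennreal (exp (- (real n + 1) * t)) \<partial>K)"
    if K: "sets K = sets (restrict_space borel {0..})" for n K
    unfolding moment[OF K, symmetric]
    by (rule integral_eq_nn_integral) (use supp[OF K] in \<open>auto simp: T_def\<close>)
  note mom = this[OF sets(1)] this[OF sets(2)]
  have "T M = T N"
  proof (rule finite_measure_eq_by_moments)
    show "finite_measure (T M)" "finite_measure (T N)"
      using fin[of 1] eq[of 1] by (auto intro!: finT sets)
    show "(\<integral>x. x ^ n \<partial>T M) = (\<integral>x. x ^ n \<partial>T N)" for n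
      using eq[of "real n + 1"] by (simp add: mom)
  qed (simp_all only: supp[OF sets(1)] supp[OF sets(2)], simp_all add: T_def)
  show ?thesis
  proof (rule measure_eqI)
    fix A assume A: "A \<in> sets M"
    then have "A \<in> sets N" using sets by simp
    with A show "emeasure M A = emeasure N A"
      using \<open>T M = T N\<close> unfolding T_def
      by (simp only: exp_tilted_image_recovers[OF sets(1) A] exp_tilted_image_recovers[OF sets(2)])
  qed (use sets in simp)
qed

section \<open>A nonnegative function with the prescribed Laplace transform\<close>

text \<open>This is \<open>sqrt pi / 2\<close> times the error function.\<close>

definition gauss_primitive :: "real \<Rightarrow> real" where
  "gauss_primitive x = (LBINT y=0..x. exp (- y\<^sup>2))"

lemma DERIV_gauss_primitive: "(gauss_primitive has_real_derivative exp (- x\<^sup>2)) (at x)"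
proof -
  have "(at x within {min 0 (x - 1)..max 0 (x + 1)}) = at x"
    by (intro at_within_interior) auto
  moreover have "min 0 (x - 1) \<le> x" "x \<le> max 0 (x + 1)"
    by auto
  moreover have "continuous_on S (\<lambda>y::real. exp (- y\<^sup>2))" for S by (intro continuous_intros)
  ultimately show ?thesis
    using interval_integral_FTC2[of "min 0 (x - 1)" 0 "max 0 (x + 1)" "\<lambda>y. exp (- y\<^sup>2)" x]
    by (auto simp: gauss_primitive_def[abs_def] zero_ereal_def has_real_derivative_iff_has_vector_derivative
        split del: if_split)
qed

lemma gauss_primitive_at_top: "(gauss_primitive \<longlongrightarrow> sqrt pi / 2) at_top"
proof -
  have g: "has_bochner_integral lborel (\<lambda>x::real. indicator {0..} x *\<^sub>R exp (- x\<^sup>2)) (sqrt pi / 2)"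
    using gaussian_moment_0 by simp
  have "((\<lambda>y. LBINT x. indicator {..y} x *\<^sub>R (indicator {0..} x *\<^sub>R exp (- x\<^sup>2))) \<longlongrightarrow> sqrt pi / 2) at_top"
    using tendsto_integral_at_top[OF sets_lborel integrable.intros[OF g]]
    by (simp only: has_bochner_integral_integral_eq[OF g])
  then show ?thesis
  proof (rule Lim_transform_eventually)
    show "\<forall>\<^sub>F y in at_top. (LBINT x. indicator {..y} x *\<^sub>R (indicator {0..} x *\<^sub>R exp (- x\<^sup>2))) = gauss_primitive y"
      using eventually_ge_at_top[of 0]
    proof eventually_elim
      case (elim y)
      have "gauss_primitive y = (LBINT x:{0..y}. exp (- x\<^sup>2))"
        unfolding gauss_primitive_def using interval_integral_Icc[of 0 y] elim by (simp add: zero_ereal_def)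
      also have "\<dots> = (LBINT x. indicator {..y} x *\<^sub>R (indicator {0..} x *\<^sub>R exp (- x\<^sup>2)))"
        unfolding set_lebesgue_integral_def
        by (intro Bochner_Integration.integral_cong) (auto simp: indicator_def)
      finally show ?case ..
    qed
  qed
qed

lemma gauss_primitive_minus: "gauss_primitive (- x) = - gauss_primitive x"
proof -
  have "gauss_primitive (- x) + gauss_primitive x = gauss_primitive (- 0) + gauss_primitive 0"
  proof (rule DERIV_isconst_all[of "\<lambda>x. gauss_primitive (- x) + gauss_primitive x" x 0])
    show "\<forall>x. ((\<lambda>x. gauss_primitive (- x) + gauss_primitive x) has_real_derivative 0) (at x)"
    proof
      fix x
      show "((\<lambda>x. gauss_primitive (- x) + gauss_primitive x) has_real_derivative 0) (at x)"
        by (rule derivative_eq_intros DERIV_chain2[OF DERIV_gauss_primitive] DERIV_gauss_primitive refl)+ simp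
    qed
  qed
  moreover have "gauss_primitive 0 = 0"
    unfolding gauss_primitive_def zero_ereal_def by (rule interval_integral_endpoints_same)
  ultimately show ?thesis by simp
qed

lemma gauss_primitive_at_bot: "(gauss_primitive \<longlongrightarrow> - sqrt pi / 2) at_bot"
proof -
  have "((\<lambda>x. - gauss_primitive (- x)) \<longlongrightarrow> - (sqrt pi / 2)) at_bot"
    by (intro tendsto_minus filterlim_compose[OF gauss_primitive_at_top] filterlim_uminus_at_top_at_bot)
  then show ?thesis by (simp add: gauss_primitive_minus)
qed

text \<open>The density of the one-sided stable law of index \<open>1 / 2\<close> (Levy distribution) with scale
  parameter \<open>r\<^sup>2 / 2\<close>; equivalently, of the first time at which a Brownian motion with variance
  \<open>2 * t\<close> reaches the level \<open>r\<close>.\<close>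

definition levy_density :: "real \<Rightarrow> real \<Rightarrow> real" where
  "levy_density r u = indicator {0<..} u * (r / (2 * sqrt pi) * exp (- r\<^sup>2 / (4 * u)) / (u * sqrt u))"

lemma levy_density_measurable [measurable]: "levy_density r \<in> borel_measurable borel"
  unfolding levy_density_def[abs_def] by measurable

text \<open>The integrand has an explicit primitive in terms of the error function, which completes the
  square in \<open>r\<^sup>2 / (4 * u) + p * u\<close> in the two possible ways.\<close>

lemma levy_density_laplace:
  assumes r: "r > 0" and p: "p > 0"
  shows "(\<integral>\<^sup>+u. ennreal (levy_density r u) * ennreal (exp (- p * u)) \<partial>lborel) = ennreal (exp (- r * sqrt p))"
proof -
  define f where "f u = r / (2 * sqrt pi) * exp (- r\<^sup>2 / (4 * u)) / (u * sqrt u) * exp (- p * u)" for u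
  define A where "A u = r / (2 * sqrt u)" for u
  define B where "B u = sqrt p * sqrt u" for u
  \<comment> \<open>Since \<open>2 * A u * B u = r * sqrt p\<close>, both prefactors turn the Gaussians at \<open>A u + B u\<close> and
    \<open>A u - B u\<close> into the same \<open>exp (- (A u)\<^sup>2 - (B u)\<^sup>2)\<close>, and the \<open>B\<close>-parts of the two inner
    derivatives cancel.\<close>
  define F where "F u = (exp (r * sqrt p) * (sqrt pi / 2 - gauss_primitive (A u + B u))
     + exp (- r * sqrt p) * (sqrt pi / 2 - gauss_primitive (A u - B u))) / sqrt pi" for u
  have dF: "(F has_real_derivative f u) (at u)" if u: "u > 0" for u
  proof -
    have dA: "(A has_real_derivative - A u / (2 * u)) (at u)"
      unfolding A_def[abs_def] using u
      by (auto intro!: derivative_eq_intros simp: field_simps)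
    have dB: "(B has_real_derivative B u / (2 * u)) (at u)"
      unfolding B_def[abs_def] using u
      by (auto intro!: derivative_eq_intros simp: field_simps)
    have AB: "2 * A u * B u = r * sqrt p" using u by (simp add: A_def B_def)
    have A2: "(A u)\<^sup>2 = r\<^sup>2 / (4 * u)" and B2: "(B u)\<^sup>2 = p * u"
      using u p by (simp_all add: A_def B_def power_divide power_mult_distrib)
    define e where "e = exp (- (A u)\<^sup>2 - (B u)\<^sup>2)"
    have e1: "exp (r * sqrt p) * exp (- (A u + B u)\<^sup>2) = e"
      unfolding e_def AB[symmetric] exp_add[symmetric] by (simp add: power2_eq_square algebra_simps)
    have e2: "exp (- r * sqrt p) * exp (- (A u - B u)\<^sup>2) = e"
      unfolding e_def mult_minus_left AB[symmetric] exp_add[symmetric] by (simp add: power2_eq_square algebra_simps)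
    have "(F has_real_derivative (exp (r * sqrt p) * (0 - exp (- (A u + B u)\<^sup>2) * (- A u / (2 * u) + B u / (2 * u)))
       + exp (- r * sqrt p) * (0 - exp (- (A u - B u)\<^sup>2) * (- A u / (2 * u) - B u / (2 * u)))) / sqrt pi) (at u)"
      unfolding F_def[abs_def]
      by (intro DERIV_cdivide DERIV_add DERIV_cmult DERIV_diff DERIV_const DERIV_chain2[OF DERIV_gauss_primitive] dA dB)
    also have "(exp (r * sqrt p) * (0 - exp (- (A u + B u)\<^sup>2) * (- A u / (2 * u) + B u / (2 * u)))
       + exp (- r * sqrt p) * (0 - exp (- (A u - B u)\<^sup>2) * (- A u / (2 * u) - B u / (2 * u)))) / sqrt pi
      = ((exp (r * sqrt p) * exp (- (A u + B u)\<^sup>2)) * (A u / (2 * u) - B u / (2 * u))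
       + (exp (- r * sqrt p) * exp (- (A u - B u)\<^sup>2)) * (A u / (2 * u) + B u / (2 * u))) / sqrt pi"
      by (simp add: algebra_simps)
    also have "\<dots> = e * (A u / u) / sqrt pi"
      unfolding e1 e2 by (simp add: algebra_simps)
    also have "e = exp (- r\<^sup>2 / (4 * u)) * exp (- p * u)"
      unfolding e_def A2 B2 by (simp add: exp_add[symmetric])
    also have "exp (- r\<^sup>2 / (4 * u)) * exp (- p * u) * (A u / u) / sqrt pi = f u"
      by (simp add: f_def A_def mult_ac)
    finally show ?thesis .
  qed
  have top: "filterlim (\<lambda>u. A u + B u) at_top at_top" "filterlim (\<lambda>u. A u - B u) at_bot at_top"
    "filterlim (\<lambda>u. A u + B u) at_top (at_right 0)" "filterlim (\<lambda>u. A u - B u) at_top (at_right 0)"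
    unfolding A_def B_def using r p real_sqrt_gt_zero[OF p] by real_asymp+
  have lim_inf: "(F \<longlongrightarrow> (exp (r * sqrt p) * (sqrt pi / 2 - sqrt pi / 2)
     + exp (- r * sqrt p) * (sqrt pi / 2 - (- sqrt pi / 2))) / sqrt pi) at_top"
    unfolding F_def[abs_def]
    by (intro tendsto_intros filterlim_compose[OF gauss_primitive_at_top] filterlim_compose[OF gauss_primitive_at_bot] top) simp
  have lim_0: "(F \<longlongrightarrow> (exp (r * sqrt p) * (sqrt pi / 2 - sqrt pi / 2)
     + exp (- r * sqrt p) * (sqrt pi / 2 - sqrt pi / 2)) / sqrt pi) (at_right 0)"
    unfolding F_def[abs_def]
    by (intro tendsto_intros filterlim_compose[OF gauss_primitive_at_top] top) simp
  have f0: "0 \<le> f u" if "u > 0" for u using that r by (simp add: f_def)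
  have FTC: "set_integrable lborel (einterval 0 \<infinity>) f"
    "(LBINT u=0..\<infinity>. f u) = exp (- r * sqrt p) - 0"
  proof -
    have 1: "((F \<circ> real_of_ereal) \<longlongrightarrow> 0) (at_right 0)"
      using lim_0 by (simp add: zero_ereal_def ereal_tendsto_simps)
    have 2: "((F \<circ> real_of_ereal) \<longlongrightarrow> exp (- r * sqrt p)) (at_left \<infinity>)"
      using lim_inf by (simp add: ereal_tendsto_simps)
    have c: "isCont f u" if "u > 0" for u
      unfolding f_def[abs_def] using that by (intro continuous_intros) auto
    show "set_integrable lborel (einterval 0 \<infinity>) f"
      by (rule interval_integral_FTC_nonneg(1)[of 0 \<infinity> F f, OF _ _ _ _ 1 2]) (use dF c f0 in auto)
    show "(LBINT u=0..\<infinity>. f u) = exp (- r * sqrt p) - 0"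
      by (rule interval_integral_FTC_nonneg(2)[of 0 \<infinity> F f, OF _ _ _ _ 1 2]) (use dF c f0 in auto)
  qed
  have ei: "einterval 0 \<infinity> = {0<..}" by (auto simp: einterval_def)
  have "(\<integral>\<^sup>+u. ennreal (levy_density r u) * ennreal (exp (- p * u)) \<partial>lborel)
      = (\<integral>\<^sup>+u. ennreal (indicator {0<..} u *\<^sub>R f u) \<partial>lborel)"
    using r by (intro nn_integral_cong)
      (auto simp: levy_density_def f_def indicator_def ennreal_mult[symmetric])
  also have "\<dots> = ennreal (LBINT u. indicator {0<..} u *\<^sub>R f u)"
    by (rule nn_integral_eq_integral)
      (use FTC(1) f0 in \<open>auto simp: ei set_integrable_def indicator_def\<close>)
  also have "(LBINT u. indicator {0<..} u *\<^sub>R f u) = exp (- r * sqrt p)"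
    using FTC(2) by (simp add: interval_lebesgue_integral_0_infty set_lebesgue_integral_def)
  finally show ?thesis .
qed

text \<open>Gamma integral after the substitution \<open>t = p * v\<close>.\<close>

lemma power_laplace:
  fixes p \<alpha> :: real
  assumes p: "p > 0" and \<alpha>: "\<alpha> \<ge> 0"
  shows "(\<integral>\<^sup>+v. ennreal (indicator {0..} v * v powr \<alpha> / Gamma (\<alpha> + 1)) * ennreal (exp (- p * v)) \<partial>lborel)
    = ennreal (1 / p powr (\<alpha> + 1))"
proof -
  have G: "Gamma (\<alpha> + 1) > 0" using \<alpha> by (intro Gamma_real_pos) auto
  have "ennreal (Gamma (\<alpha> + 1)) = (\<integral>\<^sup>+t. ennreal (indicator {0..} t * t powr \<alpha> / exp t) \<partial>lborel)"
    using Gamma_conv_nn_integral_real[of "\<alpha> + 1"] \<alpha> by simp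
  also have "\<dots> = ennreal p * (\<integral>\<^sup>+v. ennreal (indicator {0..} (p * v) * (p * v) powr \<alpha> / exp (p * v)) \<partial>lborel)"
    using nn_integral_real_affine[of "\<lambda>t. ennreal (indicator {0..} t * t powr \<alpha> / exp t)" p 0] p by simp
  also have "(\<integral>\<^sup>+v. ennreal (indicator {0..} (p * v) * (p * v) powr \<alpha> / exp (p * v)) \<partial>lborel)
     = (\<integral>\<^sup>+v. ennreal (p powr \<alpha> * Gamma (\<alpha> + 1)) * (ennreal (indicator {0..} v * v powr \<alpha> / Gamma (\<alpha> + 1)) * ennreal (exp (- p * v))) \<partial>lborel)"
  proof (rule nn_integral_cong)
    fix v :: real
    show "ennreal (indicator {0..} (p * v) * (p * v) powr \<alpha> / exp (p * v))
      = ennreal (p powr \<alpha> * Gamma (\<alpha> + 1)) * (ennreal (indicator {0..} v * v powr \<alpha> / Gamma (\<alpha> + 1)) * ennreal (exp (- p * v)))"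
      using p G by (cases "v \<ge> 0")
        (auto simp: ennreal_mult[symmetric] powr_mult exp_minus field_simps zero_le_mult_iff)
  qed
  also have "\<dots> = ennreal (p powr \<alpha> * Gamma (\<alpha> + 1)) * (\<integral>\<^sup>+v. ennreal (indicator {0..} v * v powr \<alpha> / Gamma (\<alpha> + 1)) * ennreal (exp (- p * v)) \<partial>lborel)"
    (is "_ = _ * ?I") by (rule nn_integral_cmult) measurable
  also have "ennreal p * (ennreal (p powr \<alpha> * Gamma (\<alpha> + 1)) * ?I)
      = ennreal p * ennreal (p powr \<alpha> * Gamma (\<alpha> + 1)) * ?I" by (simp only: mult.assoc)
  also have "ennreal p * ennreal (p powr \<alpha> * Gamma (\<alpha> + 1)) = ennreal (p powr (\<alpha> + 1) * Gamma (\<alpha> + 1))"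
    using p G by (subst ennreal_mult[symmetric]) (auto simp: powr_add)
  finally have eq: "ennreal (Gamma (\<alpha> + 1)) = ennreal (p powr (\<alpha> + 1) * Gamma (\<alpha> + 1)) * ?I" .
  have "ennreal (1 / (p powr (\<alpha> + 1) * Gamma (\<alpha> + 1))) * ennreal (Gamma (\<alpha> + 1))
     = ennreal (1 / (p powr (\<alpha> + 1) * Gamma (\<alpha> + 1))) * ennreal (p powr (\<alpha> + 1) * Gamma (\<alpha> + 1)) * ?I"
    by (simp only: eq mult.assoc)
  also have "ennreal (1 / (p powr (\<alpha> + 1) * Gamma (\<alpha> + 1))) * ennreal (p powr (\<alpha> + 1) * Gamma (\<alpha> + 1)) = 1"
    using p G by (subst ennreal_mult[symmetric]) auto
  also have "ennreal (1 / (p powr (\<alpha> + 1) * Gamma (\<alpha> + 1))) * ennreal (Gamma (\<alpha> + 1)) = ennreal (1 / p powr (\<alpha> + 1))"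
    using p G by (subst ennreal_mult[symmetric]) auto
  finally show ?thesis by simp
qed

text \<open>The Wright function \<open>\<Sum>n. z ^ n / (n! * Gamma (n / 2 + 1))\<close> at \<open>z = r * sqrt v\<close>. With values in
  the extended nonnegative reals the series can be integrated term by term without any
  convergence argument.\<close>

definition wright_density :: "real \<Rightarrow> real \<Rightarrow> ennreal" where
  "wright_density r v = (\<Sum>n. ennreal (r ^ n / fact n) *
     ennreal (indicator {0..} v * v powr (real n / 2) / Gamma (real n / 2 + 1)))"

lemma wright_density_measurable [measurable]: "wright_density r \<in> borel_measurable borel"
  unfolding wright_density_def[abs_def] by measurable

text \<open>Transforming term by term gives \<open>(1 / p) * (r / sqrt p) ^ n / n!\<close>, an exponential series.\<close>

lemma wright_density_laplace:
  assumes r: "r > 0" and p: "p > 0"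
  shows "(\<integral>\<^sup>+v. wright_density r v * ennreal (exp (- p * v)) \<partial>lborel) = ennreal (exp (r / sqrt p) / p)"
proof -
  let ?g = "\<lambda>n v. ennreal (indicator {0..} v * v powr (real n / 2) / Gamma (real n / 2 + 1)) * ennreal (exp (- p * v))"
  have "(\<integral>\<^sup>+v. wright_density r v * ennreal (exp (- p * v)) \<partial>lborel)
     = (\<integral>\<^sup>+v. (\<Sum>n. ennreal (r ^ n / fact n) * ?g n v) \<partial>lborel)"
    unfolding wright_density_def ennreal_suminf_multc[symmetric] by (simp only: mult.assoc)
  also have "\<dots> = (\<Sum>n. \<integral>\<^sup>+v. ennreal (r ^ n / fact n) * ?g n v \<partial>lborel)"
    by (rule nn_integral_suminf) measurable
  also have "\<dots> = (\<Sum>n. ennreal (r ^ n / fact n) * ennreal (1 / p powr (real n / 2 + 1)))"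
    by (subst nn_integral_cmult) (simp_all only: power_laplace[OF p] of_nat_0_le_iff, measurable)
  also have "\<dots> = (\<Sum>n. ennreal (1 / p * ((r / sqrt p) ^ n /\<^sub>R fact n)))"
  proof (rule suminf_cong)
    fix n
    have "p powr (real n / 2 + 1) = sqrt p ^ n * p"
      using p by (simp add: powr_add powr_half_sqrt[symmetric] powr_realpow[symmetric] powr_powr)
    then show "ennreal (r ^ n / fact n) * ennreal (1 / p powr (real n / 2 + 1)) = ennreal (1 / p * ((r / sqrt p) ^ n /\<^sub>R fact n))"
      using p r by (simp add: ennreal_mult[symmetric] power_divide field_simps)
  qed
  also have "\<dots> = ennreal (1 / p * exp (r / sqrt p))"
  proof (rule suminf_ennreal_eq)
    show "0 \<le> 1 / p * ((r / sqrt p) ^ n /\<^sub>R fact n)" for n using p r by simp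
    show "(\<lambda>n. 1 / p * ((r / sqrt p) ^ n /\<^sub>R fact n)) sums (1 / p * exp (r / sqrt p))"
      by (intro sums_mult exp_converges)
  qed
  finally show ?thesis by simp
qed

lemma convolution_laplace:
  fixes f g :: "real \<Rightarrow> ennreal"
  assumes [measurable]: "f \<in> borel_measurable borel" "g \<in> borel_measurable borel"
  shows "(\<integral>\<^sup>+t. (\<integral>\<^sup>+u. f u * g (t - u) \<partial>lborel) * ennreal (exp (- p * t)) \<partial>lborel)
    = (\<integral>\<^sup>+u. f u * ennreal (exp (- p * u)) \<partial>lborel) * (\<integral>\<^sup>+v. g v * ennreal (exp (- p * v)) \<partial>lborel)"
proof -
  let ?e = "\<lambda>x. ennreal (exp (- p * x))"
  have split: "?e t = ?e u * ?e (t - u)" for t u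
    by (simp add: ennreal_mult[symmetric] exp_add[symmetric] algebra_simps)
  have "(\<integral>\<^sup>+t. (\<integral>\<^sup>+u. f u * g (t - u) \<partial>lborel) * ?e t \<partial>lborel)
    = (\<integral>\<^sup>+t. (\<integral>\<^sup>+u. f u * g (t - u) * ?e t \<partial>lborel) \<partial>lborel)"
    by (subst nn_integral_multc) measurable
  also have "\<dots> = (\<integral>\<^sup>+u. (\<integral>\<^sup>+t. f u * g (t - u) * ?e t \<partial>lborel) \<partial>lborel)"
    by (rule lborel_pair.Fubini') measurable
  also have "\<dots> = (\<integral>\<^sup>+u. f u * ?e u * (\<integral>\<^sup>+t. g (t - u) * ?e (t - u) \<partial>lborel) \<partial>lborel)"
  proof (rule nn_integral_cong)
    fix u
    have "(\<integral>\<^sup>+t. f u * g (t - u) * ?e t \<partial>lborel) = (\<integral>\<^sup>+t. f u * ?e u * (g (t - u) * ?e (t - u)) \<partial>lborel)"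
      by (subst split[of _ u]) (simp only: mult_ac)
    also have "\<dots> = f u * ?e u * (\<integral>\<^sup>+t. g (t - u) * ?e (t - u) \<partial>lborel)"
      by (rule nn_integral_cmult) measurable
    finally show "(\<integral>\<^sup>+t. f u * g (t - u) * ?e t \<partial>lborel) = f u * ?e u * (\<integral>\<^sup>+t. g (t - u) * ?e (t - u) \<partial>lborel)" .
  qed
  also have "\<dots> = (\<integral>\<^sup>+u. f u * ?e u * (\<integral>\<^sup>+v. g v * ?e v \<partial>lborel) \<partial>lborel)"
  proof (rule nn_integral_cong)
    fix u
    have "(\<integral>\<^sup>+v. g v * ?e v \<partial>lborel) = (\<integral>\<^sup>+t. g (t - u) * ?e (t - u) \<partial>lborel)"
      using nn_integral_real_affine[of "\<lambda>v. g v * ?e v" 1 "- u"] by (simp add: algebra_simps)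
    then show "f u * ?e u * (\<integral>\<^sup>+t. g (t - u) * ?e (t - u) \<partial>lborel) = f u * ?e u * (\<integral>\<^sup>+v. g v * ?e v \<partial>lborel)"
      by simp
  qed
  also have "\<dots> = (\<integral>\<^sup>+u. f u * ?e u \<partial>lborel) * (\<integral>\<^sup>+v. g v * ?e v \<partial>lborel)"
    by (rule nn_integral_multc) measurable
  finally show ?thesis .
qed

text \<open>With \<open>p = 1 + s\<close> one has \<open>s / sqrt (1 + s) = sqrt p - 1 / sqrt p\<close>, so the prescribed transform is
  \<open>1 / (4 * pi * r)\<close> times the product of \<open>exp (- r * sqrt p)\<close> and \<open>exp (r / sqrt p) / p\<close>. Both
  factors are transforms of nonnegative functions, hence so is the product, by convolution.\<close>

lemma nonnegative_laplace_preimage: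
  assumes r: "r > 0"
  obtains h :: "real \<Rightarrow> ennreal" where "h \<in> borel_measurable borel" "\<And>t. t < 0 \<Longrightarrow> h t = 0"
    "\<And>s. s > 0 \<Longrightarrow> (\<integral>\<^sup>+t. h t * ennreal (exp (- s * t)) \<partial>lborel)
       = ennreal (1 / (4 * pi * r * (1 + s)) * exp (- r * s / sqrt (1 + s)))"
proof -
  define c where "c t = (\<integral>\<^sup>+u. ennreal (levy_density r u) * wright_density r (t - u) \<partial>lborel)" for t
  have [measurable]: "c \<in> borel_measurable borel" unfolding c_def by measurable
  define h where "h t = ennreal (1 / (4 * pi * r)) * (c t * ennreal (exp (- t)))" for t
  show ?thesis
  proof (rule that)
    show "h \<in> borel_measurable borel" unfolding h_def[abs_def] by measurable
    show "h t = 0" if "t < 0" for t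
    proof -
      have "ennreal (levy_density r u) * wright_density r (t - u) = 0" for u
      proof (cases "u > 0")
        case True
        then show ?thesis using that by (simp add: wright_density_def)
      qed (simp add: levy_density_def)
      then have "c t = 0" unfolding c_def by (simp only:) simp
      then show ?thesis by (simp add: h_def)
    qed
    fix s :: real assume s: "s > 0"
    \<comment> \<open>The factor \<open>exp (- t)\<close> in \<open>h\<close> shifts the transform variable from \<open>s\<close> to \<open>1 + s\<close>.\<close>
    define p where "p = 1 + s"
    have p: "p > 0" using s by (simp add: p_def)
    have "(\<integral>\<^sup>+t. h t * ennreal (exp (- s * t)) \<partial>lborel) = (\<integral>\<^sup>+t. ennreal (1 / (4 * pi * r)) * (c t * ennreal (exp (- p * t))) \<partial>lborel)"
    proof (rule nn_integral_cong)
      fix t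
      have "ennreal (exp (- t)) * ennreal (exp (- s * t)) = ennreal (exp (- p * t))"
        by (simp add: p_def ennreal_mult[symmetric] exp_add[symmetric] algebra_simps)
      then show "h t * ennreal (exp (- s * t)) = ennreal (1 / (4 * pi * r)) * (c t * ennreal (exp (- p * t)))"
        by (simp only: h_def mult.assoc)
    qed
    also have "\<dots> = ennreal (1 / (4 * pi * r)) * (\<integral>\<^sup>+t. c t * ennreal (exp (- p * t)) \<partial>lborel)"
      by (rule nn_integral_cmult) measurable
    also have "(\<integral>\<^sup>+t. c t * ennreal (exp (- p * t)) \<partial>lborel) = ennreal (exp (- r * sqrt p)) * ennreal (exp (r / sqrt p) / p)"
      unfolding c_def
      by (subst convolution_laplace) (simp_all only: levy_density_laplace[OF r p] wright_density_laplace[OF r p], measurable)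
    also have "ennreal (1 / (4 * pi * r)) * (ennreal (exp (- r * sqrt p)) * ennreal (exp (r / sqrt p) / p))
      = ennreal (1 / (4 * pi * r * p) * exp (- r * sqrt p + r / sqrt p))"
      unfolding exp_add using r p by (simp add: ennreal_mult[symmetric])
    also have "- r * sqrt p + r / sqrt p = - r * s / sqrt p"
    proof -
      have "sqrt p * sqrt p = 1 + s" using p by (simp add: p_def)
      then show ?thesis using p by (simp add: field_simps)
    qed
    finally show "(\<integral>\<^sup>+t. h t * ennreal (exp (- s * t)) \<partial>lborel)
       = ennreal (1 / (4 * pi * r * (1 + s)) * exp (- r * s / sqrt (1 + s)))"
      by (simp add: p_def)
  qed
qed

section \<open>Nonnegativity and the representing measure\<close>

lemma sets_half_line_lborel: "sets (restrict_space lborel {0..}) = sets (restrict_space borel {0..})"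
  by (rule sets_restrict_space_cong) simp

lemma G1_measurable_half_line:
  assumes r: "r > 0"
  shows "(\<lambda>t. G1 t r) \<in> borel_measurable (restrict_space lborel {0..})"
  by (subst measurable_cong_sets[OF sets_half_line_lborel refl])
    (rule borel_measurable_continuous_on_restrict[OF G1_continuous_on[OF r]])

text \<open>A continuous function that is negative somewhere is negative on an interval of positive length.\<close>

lemma AE_nonneg_imp_nonneg:
  fixes f :: "real \<Rightarrow> real"
  assumes f: "continuous_on {0..} f" and ae: "AE t in restrict_space lborel {0..}. f t \<ge> 0" and t: "t > 0"
  shows "f t \<ge> 0"
proof (rule ccontr)
  assume "\<not> f t \<ge> 0"
  then have neg: "f t < 0" by simp
  have "isCont f t" using f t by (intro continuous_on_interior[of "{0..}"]) (auto simp: interior_Ici[of 0 "-1"])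
  then have "\<forall>\<^sub>F x in at t. f x < 0"
    unfolding isCont_def using neg by (rule order_tendstoD)
  then obtain d where d: "d > 0" "\<And>x. x \<noteq> t \<Longrightarrow> dist x t < d \<Longrightarrow> f x < 0"
    by (auto simp: eventually_at)
  have "AE x in lborel. x \<in> {0..} \<longrightarrow> f x \<ge> 0"
    using ae by (subst (asm) AE_restrict_space_iff) auto
  then have "AE x in lborel. x \<notin> {t<..<t + d}"
  proof eventually_elim
    case (elim x)
    show ?case
    proof
      assume "x \<in> {t<..<t + d}"
      then have "f x < 0" "x \<ge> 0" using d(2)[of x] t by (auto simp: dist_real_def)
      with elim show False by auto
    qed
  qed
  then have "{t<..<t + d} \<in> null_sets lborel" by (subst AE_iff_null_sets) auto
  then have "emeasure lborel {t<..<t + d} = 0" by (rule null_setsD1)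
  with d(1) show False by simp
qed

lemma G1_laplace_half_line:
  assumes r: "r > 0" and s: "s > 0"
  shows "integrable (restrict_space lborel {0..}) (\<lambda>t. exp (- s * t) * G1 t r)"
    and "(\<integral>t. exp (- s * t) * G1 t r \<partial>restrict_space lborel {0..})
      = 1 / (4 * pi * r * (1 + s)) * exp (- r * s / sqrt (1 + s))"
  using G1_laplace[OF r s]
  by (simp_all add: integrable_restrict_space integral_restrict_space set_integrable_def set_lebesgue_integral_def)

lemma nn_laplace_density:
  fixes f :: "real \<Rightarrow> real"
  defines "L \<equiv> restrict_space lborel {0..}"
  assumes [measurable]: "f \<in> borel_measurable L"
  shows "(\<integral>\<^sup>+t. ennreal (exp (- s * t)) \<partial>density L (\<lambda>t. ennreal (f t))) = (\<integral>\<^sup>+t. ennreal (exp (- s * t) * f t) \<partial>L)"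
proof -
  have [measurable]: "(\<lambda>t. exp (- s * t)) \<in> borel_measurable L"
    unfolding L_def by (rule borel_measurable_half_line[OF sets_half_line_lborel]) measurable
  have "(\<integral>\<^sup>+t. ennreal (exp (- s * t)) \<partial>density L (\<lambda>t. ennreal (f t))) = (\<integral>\<^sup>+t. ennreal (f t) * ennreal (exp (- s * t)) \<partial>L)"
    by (rule nn_integral_density) measurable
  also have "\<dots> = (\<integral>\<^sup>+t. ennreal (exp (- s * t) * f t) \<partial>L)"
    by (rule nn_integral_cong) (subst ennreal_mult''[symmetric], auto simp: mult.commute)
  finally show ?thesis .
qed

text \<open>The oscillatory integral gives no access to the sign. But \<open>G1\<close> has the same transform as a
  nonnegative function \<open>h\<close>, so uniqueness for measures yields \<open>G1\<^sup>+ = h + G1\<^sup>-\<close> almost everywhere,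
  which is impossible where \<open>G1\<close> is negative.\<close>

lemma G1_AE_nonneg:
  assumes r: "r > 0"
  shows "AE t in restrict_space lborel {0..}. G1 t r \<ge> 0"
proof -
  define L where "L = restrict_space lborel {0::real..}"
  define F where "F s = 1 / (4 * pi * r * (1 + s)) * exp (- r * s / sqrt (1 + s))" for s
  interpret L: sigma_finite_measure L
    unfolding L_def by (rule sigma_finite_measure_restrict_space[OF sigma_finite_lborel]) simp
  obtain h :: "real \<Rightarrow> ennreal" where h: "h \<in> borel_measurable borel" "\<And>t. t < 0 \<Longrightarrow> h t = 0"
    "\<And>s. s > 0 \<Longrightarrow> (\<integral>\<^sup>+t. h t * ennreal (exp (- s * t)) \<partial>lborel) = ennreal (F s)"
    using nonnegative_laplace_preimage[OF r] unfolding F_def by metis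
  have [measurable]: "h \<in> borel_measurable L" unfolding L_def by (rule borel_measurable_half_line[OF sets_half_line_lborel h(1)])
  have [measurable]: "(\<lambda>t. G1 t r) \<in> borel_measurable L" unfolding L_def by (rule G1_measurable_half_line[OF r])
  have [measurable]: "(\<lambda>t. exp (- s * t)) \<in> borel_measurable L" for s
    unfolding L_def by (rule borel_measurable_half_line[OF sets_half_line_lborel]) measurable
  \<comment> \<open>\<open>G1\<close> is not yet known to have a sign, so its negative part is moved to the other side in
    order to compare two positive measures.\<close>
  define P where "P = density L (\<lambda>t. ennreal (G1 t r))"
  define N where "N = density L (\<lambda>t. h t + ennreal (- G1 t r))"
  have Ps: "(\<integral>\<^sup>+t. ennreal (exp (- s * t)) \<partial>P) = (\<integral>\<^sup>+t. ennreal (exp (- s * t) * G1 t r) \<partial>L)" for s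
    unfolding P_def L_def by (rule nn_laplace_density[OF G1_measurable_half_line[OF r]])
  have Ns: "(\<integral>\<^sup>+t. ennreal (exp (- s * t)) \<partial>N) = ennreal (F s) + (\<integral>\<^sup>+t. ennreal (- (exp (- s * t) * G1 t r)) \<partial>L)" if s: "s > 0" for s
  proof -
    have "(\<integral>\<^sup>+t. ennreal (exp (- s * t)) \<partial>N) = (\<integral>\<^sup>+t. (h t + ennreal (- G1 t r)) * ennreal (exp (- s * t)) \<partial>L)"
      unfolding N_def by (rule nn_integral_density) measurable
    also have "\<dots> = (\<integral>\<^sup>+t. h t * ennreal (exp (- s * t)) + ennreal (- (exp (- s * t) * G1 t r)) \<partial>L)"
    proof (rule nn_integral_cong)
      fix t
      have "ennreal (- G1 t r) * ennreal (exp (- s * t)) = ennreal (- (exp (- s * t) * G1 t r))"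
        by (subst ennreal_mult''[symmetric]) (auto simp: mult.commute)
      then show "(h t + ennreal (- G1 t r)) * ennreal (exp (- s * t)) = h t * ennreal (exp (- s * t)) + ennreal (- (exp (- s * t) * G1 t r))"
        by (simp add: distrib_right)
    qed
    also have "\<dots> = (\<integral>\<^sup>+t. h t * ennreal (exp (- s * t)) \<partial>L) + (\<integral>\<^sup>+t. ennreal (- (exp (- s * t) * G1 t r)) \<partial>L)"
      by (rule nn_integral_add) measurable
    also have "(\<integral>\<^sup>+t. h t * ennreal (exp (- s * t)) \<partial>L) = (\<integral>\<^sup>+t. h t * ennreal (exp (- s * t)) \<partial>lborel)"
      unfolding L_def using h(2)
      by (subst nn_integral_restrict_space) (auto intro!: nn_integral_cong simp: indicator_def)
    also have "\<dots> = ennreal (F s)" by (rule h(3)[OF s])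
    finally show ?thesis .
  qed
  have PN: "(\<integral>\<^sup>+t. ennreal (exp (- s * t)) \<partial>P) = (\<integral>\<^sup>+t. ennreal (exp (- s * t)) \<partial>N)"
    and fin: "(\<integral>\<^sup>+t. ennreal (exp (- s * t)) \<partial>P) < \<infinity>" if s: "s > 0" for s
  proof -
    let ?f = "\<lambda>t. exp (- s * t) * G1 t r"
    have int: "integrable L ?f" and val: "integral\<^sup>L L ?f = F s"
      using G1_laplace_half_line[OF r s] by (simp_all add: L_def F_def)
    have pos: "(\<integral>\<^sup>+t. ennreal (?f t) \<partial>L) < \<infinity>" "(\<integral>\<^sup>+t. ennreal (- ?f t) \<partial>L) < \<infinity>"
      using int by (auto simp: real_integrable_def less_top)
    show "(\<integral>\<^sup>+t. ennreal (exp (- s * t)) \<partial>P) < \<infinity>" unfolding Ps by (rule pos(1))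
    have "F s = enn2real (\<integral>\<^sup>+t. ennreal (?f t) \<partial>L) - enn2real (\<integral>\<^sup>+t. ennreal (- ?f t) \<partial>L)"
      unfolding val[symmetric] by (rule real_lebesgue_integral_def[OF int])
    then have "enn2real (\<integral>\<^sup>+t. ennreal (?f t) \<partial>L) = F s + enn2real (\<integral>\<^sup>+t. ennreal (- ?f t) \<partial>L)" by simp
    then have "ennreal (enn2real (\<integral>\<^sup>+t. ennreal (?f t) \<partial>L)) = ennreal (F s + enn2real (\<integral>\<^sup>+t. ennreal (- ?f t) \<partial>L))" by simp
    moreover have "F s \<ge> 0" using r s by (simp add: F_def)
    ultimately show "(\<integral>\<^sup>+t. ennreal (exp (- s * t)) \<partial>P) = (\<integral>\<^sup>+t. ennreal (exp (- s * t)) \<partial>N)"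
      unfolding Ps Ns[OF s] using pos by (simp add: ennreal_plus)
  qed
  have "P = N"
  proof (rule laplace_transform_determines_measure)
    show "sets P = sets (restrict_space borel {0..})" "sets N = sets (restrict_space borel {0..})"
      by (simp_all add: P_def N_def L_def sets_half_line_lborel)
  qed (use PN fin in auto)
  then have "AE t in L. ennreal (G1 t r) = h t + ennreal (- G1 t r)"
    unfolding P_def N_def by (intro L.density_unique) auto
  then show ?thesis
    unfolding L_def
  proof eventually_elim
    case (elim t)
    show ?case
    proof (rule ccontr)
      assume "\<not> 0 \<le> G1 t r"
      then have "ennreal (G1 t r) = 0" "ennreal (- G1 t r) > 0" by (auto simp: ennreal_neg)
      with elim show False by simp
    qed
  qed
qed

text \<open>On a compact set \<open>1 \<le> exp T * exp (- t)\<close> for some \<open>T\<close>, so local finiteness follows from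
  finiteness of the transform at \<open>s = 1\<close>.\<close>

lemma G1_density_has_laplace_kernel:
  assumes r: "r > 0"
  shows "has_laplace_kernel r (density (restrict_space lborel {0..}) (\<lambda>t. ennreal (G1 t r)))"
proof -
  define L where "L = restrict_space lborel {0::real..}"
  define M where "M = density L (\<lambda>t. ennreal (G1 t r))"
  have [measurable]: "(\<lambda>t. G1 t r) \<in> borel_measurable L" unfolding L_def by (rule G1_measurable_half_line[OF r])
  have [measurable]: "(\<lambda>t. exp (- s * t)) \<in> borel_measurable L" for s
    unfolding L_def by (rule borel_measurable_half_line[OF sets_half_line_lborel]) measurable
  have setsM: "sets M = sets (restrict_space borel {0..})"
    by (simp add: M_def L_def sets_half_line_lborel)
  have lap: "(\<integral>\<^sup>+t. ennreal (exp (- s * t)) \<partial>M) = ennreal (1 / (4 * pi * r * (1 + s)) * exp (- r * s / sqrt (1 + s)))"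
    if s: "s > 0" for s
  proof -
    have "(\<integral>\<^sup>+t. ennreal (exp (- s * t)) \<partial>M) = (\<integral>\<^sup>+t. ennreal (exp (- s * t) * G1 t r) \<partial>L)"
      unfolding M_def L_def by (rule nn_laplace_density[OF G1_measurable_half_line[OF r]])
    also have "\<dots> = ennreal (\<integral>t. exp (- s * t) * G1 t r \<partial>L)"
    proof (rule nn_integral_eq_integral)
      show "integrable L (\<lambda>t. exp (- s * t) * G1 t r)"
        unfolding L_def by (rule G1_laplace_half_line(1)[OF r s])
      show "AE t in L. 0 \<le> exp (- s * t) * G1 t r"
        using G1_AE_nonneg[OF r] unfolding L_def by eventually_elim simp
    qed
    finally show ?thesis by (simp only: L_def G1_laplace_half_line(2)[OF r s])
  qed
  have "emeasure M C < \<infinity>" if C: "compact C" "C \<subseteq> {0..}" for C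
  proof -
    obtain T where T: "\<And>t. t \<in> C \<Longrightarrow> t \<le> T"
      using compact_imp_bounded[OF C(1)] by (auto simp: bounded_real abs_le_iff)
    have CM: "C \<in> sets M" using C setsM by (auto simp: sets_restrict_space_iff borel_compact)
    then have "emeasure M C = (\<integral>\<^sup>+t. indicator C t \<partial>M)" by simp
    also have "\<dots> \<le> (\<integral>\<^sup>+t. ennreal (exp T) * ennreal (exp (- 1 * t)) \<partial>M)"
    proof (rule nn_integral_mono)
      fix t
      have "1 \<le> exp T * exp (- 1 * t)" if "t \<in> C" using T[OF that] by (simp add: exp_add[symmetric])
      then show "indicator C t \<le> ennreal (exp T) * ennreal (exp (- 1 * t))"
        by (auto simp: indicator_def ennreal_mult[symmetric] simp del: mult_minus1)
    qed
    also have "\<dots> = ennreal (exp T) * (\<integral>\<^sup>+t. ennreal (exp (- 1 * t)) \<partial>M)"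
      unfolding M_def by (rule nn_integral_cmult) measurable
    also have "\<dots> < \<infinity>" unfolding lap[OF zero_less_one] by (simp add: ennreal_mult_less_top)
    finally show ?thesis .
  qed
  with setsM lap show ?thesis
    unfolding has_laplace_kernel_def radon_on_half_line_def M_def L_def by blast
qed

theorem lemma4p2:
  fixes r :: real
  assumes "r > 0"
  shows "(\<forall>t>0. (G1_trunc t r \<longlongrightarrow> G1 t r) at_top)
    \<and> continuous_on {0<..} (\<lambda>t. G1 t r)
    \<and> (\<forall>T>0. set_integrable lborel {0..T} (\<lambda>t. G1 t r))
    \<and> (\<forall>s>0. set_integrable lborel {0..} (\<lambda>t. exp (- s * t) * G1 t r)
          \<and> (LBINT t:{0..}. exp (- s * t) * G1 t r)
              = 1 / (4 * pi * r * (1 + s)) * exp (- r * s / sqrt (1 + s)))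
    \<and> (\<exists>!M. has_laplace_kernel r M)
    \<and> (\<forall>M. has_laplace_kernel r M \<longrightarrow>
          absolutely_continuous (restrict_space lborel {0..}) M
          \<and> M = density (restrict_space lborel {0..}) (\<lambda>t. ennreal (G1 t r)))
    \<and> (\<forall>t>0. G1 t r \<ge> 0)"
proof -
  note r = assms
  let ?M = "density (restrict_space lborel {0..}) (\<lambda>t. ennreal (G1 t r))"
  note kernel = G1_density_has_laplace_kernel[OF r]
  have unique: "M = ?M" if M: "has_laplace_kernel r M" for M
  proof (rule laplace_transform_determines_measure)
    show "sets M = sets (restrict_space borel {0..})" "sets ?M = sets (restrict_space borel {0..})"
      using M kernel by (auto simp: has_laplace_kernel_def radon_on_half_line_def)
    show "(\<integral>\<^sup>+t. ennreal (exp (- s * t)) \<partial>M) < \<infinity>"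
      "(\<integral>\<^sup>+t. ennreal (exp (- s * t)) \<partial>M) = (\<integral>\<^sup>+t. ennreal (exp (- s * t)) \<partial>?M)" if "s > 0" for s
      using M kernel that unfolding has_laplace_kernel_def by simp_all
  qed
  have ac: "absolutely_continuous (restrict_space lborel {0..}) ?M"
    by (rule absolutely_continuousI_density) (use G1_measurable_half_line[OF r] in measurable)
  show ?thesis
  proof (intro conjI allI impI)
    show "(G1_trunc t r \<longlongrightarrow> G1 t r) at_top" if "t > 0" for t
      using that by (intro G1_trunc_tendsto_uniformly(1) r) simp
    show "continuous_on {0<..} (\<lambda>t. G1 t r)"
      by (rule continuous_on_subset[OF G1_continuous_on[OF r]]) auto
    show "set_integrable lborel {0..T} (\<lambda>t. G1 t r)" for T
      by (rule borel_integrable_atLeastAtMost', rule continuous_on_subset[OF G1_continuous_on[OF r]]) auto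
    show "set_integrable lborel {0..} (\<lambda>t. exp (- s * t) * G1 t r)"
      "(LBINT t:{0..}. exp (- s * t) * G1 t r) = 1 / (4 * pi * r * (1 + s)) * exp (- r * s / sqrt (1 + s))"
      if "s > 0" for s
      using G1_laplace[OF r that] by auto
    show "\<exists>!M. has_laplace_kernel r M" using kernel unique by blast
    show "absolutely_continuous (restrict_space lborel {0..}) M" if "has_laplace_kernel r M" for M
      using ac unique[OF that] by simp
    show "M = ?M" if "has_laplace_kernel r M" for M by (rule unique[OF that])
    show "G1 t r \<ge> 0" if "t > 0" for t
      by (rule AE_nonneg_imp_nonneg[OF G1_continuous_on[OF r] G1_AE_nonneg[OF r] that])
  qed
qed

end
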